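(* Let $\Omega\subset\mathbb{C}^n$ be a bounded pseudoconvex Reinhardt domain, $1<p<\infty$, $q=p/(p-1)$, and $\lambda$ an admissible multi-radial weight on $\Omega$. If the Monomial Basis Projection $\bm{P}^{\Omega}_{p,\lambda}:L^p(\Omega,\lambda)\to A^p(\Omega,\lambda)$ exists, then for every $f\in L^p(\Omega,\lambda)$ and $z\in\Omega$, $$\bm{P}^{\Omega}_{p,\lambda}(f)(z)=\int_\Omega K^{\Omega}_{p,\lambda}(z,w)f(w)\lambda(w)\,dV(w),$$ and for each $z\in\Omega$ we have $K^{\Omega}_{p,\lambda}(z,\cdot)\in L^q(\Omega,\lambda)$.
   Context: A domain $\Omega$ is Reinhardt (centered at $0$) if $(e^{i\theta_1}z_1,\dots,e^{i\theta_n}z_n)\in\Omega$ whenever $z\in\Omega$, $\theta\in\mathbb{R}^n$. For a measurable $\lambda:\Omega\to[0,\infty]$, positive a.e., $\|f\|_{p,\lambda}^p=\int_\Omega|f|^p\lambda\,dV$ ($dV$ Lebesgue measure), $L^p(\Omega,\lambda)$ is the corresponding space and $A^p(\Omega,\lambda)=L^p(\Omega,\lambda)\cap\mathcal{O}(\Omega)$. $\lambda$ is admissible if for each compact $K\subset\Omega$ there is $C_K$ with $\sup_K|f|\le C_K\|f\|_{p,\lambda}$ for all $f\in A^p(\Omega,\lambda)$; multi-radial if $\lambda(z)$ depends only on $(|z_1|,\dots,|z_n|)$. $e_\alpha(z)=z_1^{\alpha_1}\cdots z_n^{\alpha_n}$ for $\alpha\in\mathbb{Z}^n$, $|\alpha|_\infty=\max_j|\alpha_j|$,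 $\mathcal{S}_p(\Omega,\lambda)=\{\alpha:e_\alpha\in A^p(\Omega,\lambda)\}$. Monomial Basis Kernel: $K^{\Omega}_{p,\lambda}(z,w)=\sum_{\alpha\in\mathcal{S}_p(\Omega,\lambda)}e_\alpha(z)\overline{e_\alpha(w)}|e_\alpha(w)|^{p-2}/\|e_\alpha\|_{p,\lambda}^p$. Each $f\in\mathcal{O}(\Omega)$ has a unique locally normally convergent Laurent expansion $f=\sum_\alpha c_\alpha e_\alpha$; set $a_\alpha(f)=c_\alpha$. Restricted to $A^p(\Omega,\lambda)$, $a_\alpha$ is bounded, and $\widetilde{a}_\alpha$ denotes its unique norm-preserving extension to $L^p(\Omega,\lambda)$. The Monomial Basis Projection of $A^p(\Omega,\lambda)$ (if it exists) is a bounded linear projection $\bm{P}^\Omega_{p,\lambda}$ from $L^p(\Omega,\lambda)$ onto $A^p(\Omega,\lambda)$ such that for every $f\in L^p(\Omega,\lambda)$, $\bm{P}^\Omega_{p,\lambda}f=\lim_{N\to\infty}\sum_{\alpha\in\mathcal{S}_p(\Omega,\lambda),|\alpha|_\infty\le N}\widetilde{a}_\alpha(f)e_\alpha$ in the norm of $L^p(\Omega,\lambda)$. *)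

theory Defs
  imports "HOL-Analysis.Analysis"
begin

definition cdomain :: "(complex^'n) set \<Rightarrow> bool" where
  "cdomain \<Omega> \<longleftrightarrow> open \<Omega> \<and> connected \<Omega> \<and> \<Omega> \<noteq> {}"

definition reinhardt :: "(complex^'n) set \<Rightarrow> bool" where
  "reinhardt \<Omega> \<longleftrightarrow>
     (\<forall>z\<in>\<Omega>. \<forall>\<theta>::'n \<Rightarrow> real. (\<chi> j. exp (\<i> * of_real (\<theta> j)) * z$j) \<in> \<Omega>)"

definition cont_psh :: "(complex^'n) set \<Rightarrow> (complex^'n \<Rightarrow> real) \<Rightarrow> bool" where
  "cont_psh \<Omega> u \<longleftrightarrow> continuous_on \<Omega> u \<and>
     (\<forall>a b. (\<forall>\<zeta>::complex. norm \<zeta> \<le> 1 \<longrightarrow> a + \<zeta> *s b \<in> \<Omega>) \<longrightarrow>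
        u a \<le> (1 / (2*pi)) * integral {0..2*pi} (\<lambda>t. u (a + exp (\<i> * of_real t) *s b)))"

definition pseudoconvex :: "(complex^'n) set \<Rightarrow> bool" where
  "pseudoconvex \<Omega> \<longleftrightarrow> (\<exists>\<phi>. cont_psh \<Omega> \<phi> \<and>
     (\<forall>c::real. compact (closure {z\<in>\<Omega>. \<phi> z < c}) \<and> closure {z\<in>\<Omega>. \<phi> z < c} \<subseteq> \<Omega>))"

definition holo_n :: "(complex^'n) set \<Rightarrow> (complex^'n \<Rightarrow> complex) \<Rightarrow> bool" where
  "holo_n \<Omega> f \<longleftrightarrow> (\<forall>z\<in>\<Omega>. \<exists>L. (f has_derivative L) (at z) \<and> (\<forall>c v. L (c *s v) = c * L v))"

definition wmeasure :: "(complex^'n) set \<Rightarrow> (complex^'n \<Rightarrow> ennreal) \<Rightarrow> (complex^'n) measure" where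
  "wmeasure \<Omega> wt = density lebesgue (\<lambda>z. wt z * indicator \<Omega> z)"

definition Lp_space :: "(complex^'n) set \<Rightarrow> (complex^'n \<Rightarrow> ennreal) \<Rightarrow> real \<Rightarrow> (complex^'n \<Rightarrow> complex) set" where
  "Lp_space \<Omega> wt p = {f. f \<in> borel_measurable (wmeasure \<Omega> wt) \<and>
      (\<integral>\<^sup>+ z. ennreal (norm (f z) powr p) \<partial>wmeasure \<Omega> wt) < \<infinity>}"

definition Lpnorm :: "(complex^'n) set \<Rightarrow> (complex^'n \<Rightarrow> ennreal) \<Rightarrow> real \<Rightarrow> (complex^'n \<Rightarrow> complex) \<Rightarrow> real" where
  "Lpnorm \<Omega> wt p f = enn2real (\<integral>\<^sup>+ z. ennreal (norm (f z) powr p) \<partial>wmeasure \<Omega> wt) powr (1/p)"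

definition Ap_space :: "(complex^'n) set \<Rightarrow> (complex^'n \<Rightarrow> ennreal) \<Rightarrow> real \<Rightarrow> (complex^'n \<Rightarrow> complex) set" where
  "Ap_space \<Omega> wt p = {f \<in> Lp_space \<Omega> wt p. holo_n \<Omega> f}"

definition admissible :: "(complex^'n) set \<Rightarrow> (complex^'n \<Rightarrow> ennreal) \<Rightarrow> real \<Rightarrow> bool" where
  "admissible \<Omega> wt p \<longleftrightarrow> (\<forall>K. compact K \<and> K \<subseteq> \<Omega> \<longrightarrow>
     (\<exists>C. \<forall>f\<in>Ap_space \<Omega> wt p. \<forall>z\<in>K. norm (f z) \<le> C * Lpnorm \<Omega> wt p f))"

definition multi_radial :: "(complex^'n) set \<Rightarrow> (complex^'n \<Rightarrow> ennreal) \<Rightarrow> bool" where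
  "multi_radial \<Omega> wt \<longleftrightarrow>
     (\<forall>z\<in>\<Omega>. \<forall>w\<in>\<Omega>. (\<forall>j. norm (z$j) = norm (w$j)) \<longrightarrow> wt z = wt w)"

definition monom :: "('n::finite \<Rightarrow> int) \<Rightarrow> complex^'n \<Rightarrow> complex" where
  "monom \<alpha> z = (\<Prod>j\<in>UNIV. (z$j) powi (\<alpha> j))"

definition supnorm :: "('n::finite \<Rightarrow> int) \<Rightarrow> int" where
  "supnorm \<alpha> = Max (range (\<lambda>j. \<bar>\<alpha> j\<bar>))"

definition Sp_set :: "(complex^'n::finite) set \<Rightarrow> (complex^'n \<Rightarrow> ennreal) \<Rightarrow> real \<Rightarrow> ('n \<Rightarrow> int) set" where
  "Sp_set \<Omega> wt p = {\<alpha>. monom \<alpha> \<in> Ap_space \<Omega> wt p}"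

definition laurent_series :: "(complex^'n::finite) set \<Rightarrow> (complex^'n \<Rightarrow> complex) \<Rightarrow> (('n \<Rightarrow> int) \<Rightarrow> complex) \<Rightarrow> bool" where
  "laurent_series \<Omega> f c \<longleftrightarrow>
     (\<forall>z\<in>\<Omega>. ((\<lambda>\<alpha>. c \<alpha> * monom \<alpha> z) has_sum f z) UNIV) \<and>
     (\<forall>K. compact K \<and> K \<subseteq> \<Omega> \<and> K \<noteq> {} \<longrightarrow>
        (\<lambda>\<alpha>. SUP z\<in>K. norm (c \<alpha> * monom \<alpha> z)) summable_on UNIV)"

definition laurent_coeff :: "(complex^'n::finite) set \<Rightarrow> ('n \<Rightarrow> int) \<Rightarrow> (complex^'n \<Rightarrow> complex) \<Rightarrow> complex" where
  "laurent_coeff \<Omega> \<alpha> f = (THE c. laurent_series \<Omega> f c) \<alpha>"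

definition coeff_opnorm :: "(complex^'n::finite) set \<Rightarrow> (complex^'n \<Rightarrow> ennreal) \<Rightarrow> real \<Rightarrow> ('n \<Rightarrow> int) \<Rightarrow> real" where
  "coeff_opnorm \<Omega> wt p \<alpha> = Sup ({norm (laurent_coeff \<Omega> \<alpha> f) / Lpnorm \<Omega> wt p f | f.
       f \<in> Ap_space \<Omega> wt p \<and> Lpnorm \<Omega> wt p f > 0} \<union> {0})"

text \<open>The norm-preserving (Hahn-Banach) extension of a_alpha to L^p
  (normalised to be 0 outside L^p so that it is unique as a HOL function).\<close>
definition ext_coeff :: "(complex^'n::finite) set \<Rightarrow> (complex^'n \<Rightarrow> ennreal) \<Rightarrow> real \<Rightarrow> ('n \<Rightarrow> int)
     \<Rightarrow> (complex^'n \<Rightarrow> complex) \<Rightarrow> complex" where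
  "ext_coeff \<Omega> wt p \<alpha> = (THE \<Phi>.
      (\<forall>f. f \<notin> Lp_space \<Omega> wt p \<longrightarrow> \<Phi> f = 0) \<and>
      (\<forall>f\<in>Ap_space \<Omega> wt p. \<Phi> f = laurent_coeff \<Omega> \<alpha> f) \<and>
      (\<forall>f\<in>Lp_space \<Omega> wt p. \<forall>g\<in>Lp_space \<Omega> wt p. \<Phi> (\<lambda>z. f z + g z) = \<Phi> f + \<Phi> g) \<and>
      (\<forall>f\<in>Lp_space \<Omega> wt p. \<forall>c. \<Phi> (\<lambda>z. c * f z) = c * \<Phi> f) \<and>
      (\<forall>f\<in>Lp_space \<Omega> wt p. norm (\<Phi> f) \<le> coeff_opnorm \<Omega> wt p \<alpha> * Lpnorm \<Omega> wt p f))"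

definition trunc_set :: "(complex^'n::finite) set \<Rightarrow> (complex^'n \<Rightarrow> ennreal) \<Rightarrow> real \<Rightarrow> nat \<Rightarrow> ('n \<Rightarrow> int) set" where
  "trunc_set \<Omega> wt p N = {\<alpha> \<in> Sp_set \<Omega> wt p. supnorm \<alpha> \<le> int N}"

definition is_MBP :: "(complex^'n::finite) set \<Rightarrow> (complex^'n \<Rightarrow> ennreal) \<Rightarrow> real
     \<Rightarrow> ((complex^'n \<Rightarrow> complex) \<Rightarrow> (complex^'n \<Rightarrow> complex)) \<Rightarrow> bool" where
  "is_MBP \<Omega> wt p P \<longleftrightarrow>
     (\<forall>f\<in>Lp_space \<Omega> wt p. P f \<in> Ap_space \<Omega> wt p) \<and>
     (\<forall>f\<in>Lp_space \<Omega> wt p. \<forall>g\<in>Lp_space \<Omega> wt p. \<forall>z\<in>\<Omega>. P (\<lambda>w. f w + g w) z = P f z + P g z) \<and>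
     (\<forall>f\<in>Lp_space \<Omega> wt p. \<forall>c. \<forall>z\<in>\<Omega>. P (\<lambda>w. c * f w) z = c * P f z) \<and>
     (\<exists>C. \<forall>f\<in>Lp_space \<Omega> wt p. Lpnorm \<Omega> wt p (P f) \<le> C * Lpnorm \<Omega> wt p f) \<and>
     (\<forall>g\<in>Ap_space \<Omega> wt p. \<forall>z\<in>\<Omega>. P g z = g z) \<and>
     (\<forall>f\<in>Lp_space \<Omega> wt p.
        (\<lambda>N. Lpnorm \<Omega> wt p (\<lambda>z. P f z -
            (\<Sum>\<alpha>\<in>trunc_set \<Omega> wt p N. ext_coeff \<Omega> wt p \<alpha> f * monom \<alpha> z))) \<longlonglongrightarrow> 0)"

definition mb_kernel :: "(complex^'n::finite) set \<Rightarrow> (complex^'n \<Rightarrow> ennreal) \<Rightarrow> real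
     \<Rightarrow> complex^'n \<Rightarrow> complex^'n \<Rightarrow> complex" where
  "mb_kernel \<Omega> wt p z w = lim (\<lambda>N. \<Sum>\<alpha>\<in>trunc_set \<Omega> wt p N.
      monom \<alpha> z * cnj (monom \<alpha> w) * of_real (norm (monom \<alpha> w) powr (p - 2))
        / of_real (Lpnorm \<Omega> wt p (monom \<alpha>) powr p))"

end

theory Submission
  imports Defs
begin

text \<open>
  Write \<open>\<parallel>\<cdot>\<parallel>\<close> for the norm of \<open>L\<^sup>p(\<Omega>, \<lambda>)\<close>. The weighted measure is invariant under the torus, so the
  norming functional \<open>\<ell>\<^sub>\<alpha>(f) = \<parallel>e\<^sub>\<alpha>\<parallel>\<^sup>-\<^sup>p \<integral> f cnj(e\<^sub>\<alpha>) \<bar>e\<^sub>\<alpha>\<bar>\<^sup>p\<^sup>-\<^sup>2 \<lambda>\<close> takes the value 1 at \<open>e\<^sub>\<alpha>\<close> and 0 at all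
  other monomials, and by Hoelder its norm is \<open>1 / \<parallel>e\<^sub>\<alpha>\<parallel>\<close>. Since every \<open>g\<close> in \<open>A\<^sup>p\<close> is fixed by the
  projection, it is a norm limit of Laurent polynomials; this identifies its Laurent coefficients with
  \<open>\<ell>\<^sub>\<alpha>(g)\<close>, and smoothness of the \<open>L\<^sup>p\<close> norm makes \<open>\<ell>\<^sub>\<alpha>\<close> the only norm-preserving extension.

  The series of the kernel converges because admissibility, applied to a slightly larger compact set,
  gives \<open>\<bar>e\<^sub>\<alpha>(z)\<bar> \<le> C \<rho>\<^sup>\<bar>\<^sup>\<alpha>\<^sup>\<bar> \<parallel>e\<^sub>\<alpha>\<parallel>\<close> with \<open>\<rho> < 1\<close>: the \<open>L\<^sup>q\<close> norms of its terms are
  \<open>\<bar>e\<^sub>\<alpha>(z)\<bar> / \<parallel>e\<^sub>\<alpha>\<parallel>\<close>, hence summable. The integral formula follows by dominated convergence.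
\<close>

section \<open>Linear isometries preserve Lebesgue measure\<close>

lemma emeasure_lborel_negligible_diff:
  assumes "open V" "open W" "W \<subseteq> V" "negligible (V - W)"
  shows "emeasure lborel V = emeasure lborel W"
proof -
  have "emeasure lebesgue V = emeasure lebesgue (W \<union> (V - W))"
    using assms(3) by (simp add: Un_absorb1)
  also have "\<dots> = emeasure lebesgue W"
    using assms(2,4) by (intro emeasure_Un_null_set) (auto simp: negligible_iff_null_sets)
  finally show ?thesis using assms(1,2) by simp
qed

lemma open_disjoint_balls_negligible_rest:
  fixes U :: "'a::euclidean_space set"
  assumes "open U"
  obtains C :: "('a \<times> real) set" where "countable C"
    "disjoint_family_on (\<lambda>i. ball (fst i) (snd i)) C"
    "(\<Union>i\<in>C. ball (fst i) (snd i)) \<subseteq> U" "negligible (U - (\<Union>i\<in>C. ball (fst i) (snd i)))"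
proof (rule Vitali_covering_theorem_balls[of U "{i. ball (fst i) (snd i) \<subseteq> U}" fst snd])
  fix x and d :: real assume "x \<in> U" "0 < d"
  then obtain e where "0 < e" "ball x e \<subseteq> U" using assms open_contains_ball by blast
  then show "\<exists>i. i \<in> {i. ball (fst i) (snd i) \<subseteq> U} \<and> x \<in> ball (fst i) (snd i) \<and> snd i < d"
    using \<open>0 < d\<close> by (intro exI[of _ "(x, min e (d/2))"]) auto
next
  fix C assume "C \<subseteq> {i. ball (fst i) (snd i) \<subseteq> U}"
    and "pairwise (\<lambda>i j. disjnt (ball (fst i) (snd i)) (ball (fst j) (snd j))) C"
    and "countable C" "negligible (U - (\<Union>i\<in>C. ball (fst i) (snd i)))"
  then show thesis
    by (intro that[of C]) (auto simp: disjoint_family_on_def pairwise_def disjnt_def)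
qed

text \<open>A linear isometry maps disjoint balls to disjoint balls of the same radius.\<close>
lemma emeasure_lborel_orthogonal_image_open:
  fixes T :: "'a::euclidean_space \<Rightarrow> 'a"
  assumes T: "orthogonal_transformation T" and U: "open U"
  shows "emeasure lborel (T ` U) = emeasure lborel U"
proof -
  define b where "b i = ball (fst i) (snd i)" for i :: "'a \<times> real"
  have open_b: "open (b i)" for i by (simp add: b_def)
  have image_b: "T ` b i = ball (T (fst i)) (snd i)" for i
    unfolding b_def by (rule image_orthogonal_transformation_ball[OF T])
  then have open_image_b: "open (T ` b i)" for i by simp
  have emeasure_b: "emeasure lborel (T ` b i) = emeasure lborel (b i)" for i
    unfolding image_b by (cases "0 \<le> snd i") (simp_all add: b_def emeasure_ball ball_empty)
  have inj: "inj T" and linear: "linear T"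
    using T by (simp_all add: orthogonal_transformation_inj orthogonal_transformation_linear)
  obtain C where C: "countable C" "disjoint_family_on b C" "(\<Union>i\<in>C. b i) \<subseteq> U"
    and null: "negligible (U - (\<Union>i\<in>C. b i))"
    using open_disjoint_balls_negligible_rest[OF U] unfolding b_def by blast
  have "negligible (T ` (U - (\<Union>i\<in>C. b i)))"
    using null linear
    by (intro negligible_differentiable_image_negligible linear_imp_differentiable_on) auto
  then have "negligible (T ` U - (\<Union>i\<in>C. T ` b i))"
    by (simp add: image_set_diff[OF inj] image_UN)
  then have "emeasure lborel (T ` U) = emeasure lborel (\<Union>i\<in>C. T ` b i)"
    using C(3) T U linear by (intro emeasure_lborel_negligible_diff)
      (auto simp: open_image_b open_surjective_linear_image orthogonal_transformation_surj)
  also have "\<dots> = (\<integral>\<^sup>+i. emeasure lborel (T ` b i) \<partial>count_space C)"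
    using C(1,2) by (intro emeasure_UN_countable)
      (simp_all add: open_image_b disjoint_family_on_def image_Int[OF inj, symmetric])
  also have "\<dots> = (\<integral>\<^sup>+i. emeasure lborel (b i) \<partial>count_space C)"
    by (simp only: emeasure_b)
  also have "\<dots> = emeasure lborel (\<Union>i\<in>C. b i)"
    using C(1,2) by (intro emeasure_UN_countable[symmetric]) (auto simp: open_b)
  also have "\<dots> = emeasure lborel U"
    using C(3) U null by (intro emeasure_lborel_negligible_diff[symmetric]) (auto simp: open_b)
  finally show ?thesis .
qed

lemma borel_measurable_orthogonal_transformation:
  fixes T :: "'a::euclidean_space \<Rightarrow> 'a"
  assumes "orthogonal_transformation T"
  shows "T \<in> borel_measurable borel"
  using orthogonal_transformation_linear[OF assms]
  by (intro borel_measurable_continuous_onI linear_continuous_on) (simp add: linear_conv_bounded_linear)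

lemma distr_lborel_orthogonal_transformation:
  fixes T :: "'a::euclidean_space \<Rightarrow> 'a"
  assumes T: "orthogonal_transformation T"
  shows "distr lborel borel T = lborel"
proof (rule lborel_eqI[symmetric])
  note [measurable] = borel_measurable_orthogonal_transformation[OF T]
  fix l u :: 'a
  assume ordered: "\<And>b. b \<in> Basis \<Longrightarrow> l \<bullet> b \<le> u \<bullet> b"
  have "emeasure (distr lborel borel T) (box l u) = emeasure lborel (inv T ` box l u)"
    using T by (simp add: emeasure_distr bij_vimage_eq_inv_image orthogonal_transformation_bij)
  also have "\<dots> = emeasure lborel (box l u)"
    using T by (intro emeasure_lborel_orthogonal_image_open orthogonal_transformation_inv) auto
  finally show "emeasure (distr lborel borel T) (box l u) = ennreal (\<Prod>b\<in>Basis. (u - l) \<bullet> b)"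
    by (simp add: emeasure_lborel_box_eq ordered)
qed simp

lemma
  fixes T :: "'a::euclidean_space \<Rightarrow> 'a"
  assumes T: "orthogonal_transformation T"
  shows measurable_lebesgue_orthogonal_transformation: "T \<in> lebesgue \<rightarrow>\<^sub>M lebesgue"
    and distr_lebesgue_orthogonal_transformation: "distr lebesgue lebesgue T = lebesgue"
proof -
  note [measurable] = borel_measurable_orthogonal_transformation[OF T]
  have distr: "distr lebesgue lborel T = lborel"
    using distr_lborel_orthogonal_transformation[OF T] by (simp add: distr_completion cong: distr_cong)
  then have null_sets: "null_sets lborel = null_sets (distr lebesgue lborel T)"
    by simp
  show "T \<in> lebesgue \<rightarrow>\<^sub>M lebesgue"
    by (simp add: completion.measurable_completion2 null_sets measurable_completion)
  have "distr lebesgue lebesgue T = completion (distr lebesgue lborel T)"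
    by (subst completion.completion_distr_eq) (auto simp: null_sets measurable_completion)
  then show "distr lebesgue lebesgue T = lebesgue"
    by (simp add: distr)
qed

section \<open>Spaces of \<open>p\<close>-integrable functions\<close>

definition p_integrable ::
    "'a measure \<Rightarrow> real \<Rightarrow> ('a \<Rightarrow> 'b::{second_countable_topology, real_normed_vector}) \<Rightarrow> bool" where
  "p_integrable M p f \<longleftrightarrow> f \<in> borel_measurable M \<and> integrable M (\<lambda>x. norm (f x) powr p)"

definition p_norm :: "'a measure \<Rightarrow> real \<Rightarrow> ('a \<Rightarrow> 'b::real_normed_vector) \<Rightarrow> real" where
  "p_norm M p f = (\<integral>x. norm (f x) powr p \<partial>M) powr (1/p)"

lemma borel_measurable_p_integrable: "p_integrable M p f \<Longrightarrow> f \<in> borel_measurable M"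
  and integrable_norm_powr: "p_integrable M p f \<Longrightarrow> integrable M (\<lambda>x. norm (f x) powr p)"
  by (simp_all add: p_integrable_def)

lemma p_norm_nonneg: "0 \<le> p_norm M p f"
  by (simp add: p_norm_def)

lemma p_norm_powr: "0 < p \<Longrightarrow> p_norm M p f powr p = (\<integral>x. norm (f x) powr p \<partial>M)"
  by (simp add: p_norm_def powr_powr)

lemma p_norm_eq_0_imp_AE:
  assumes "p_integrable M p f" "0 < p" "p_norm M p f = 0"
  shows "AE x in M. f x = 0"
proof -
  have "(\<integral>x. norm (f x) powr p \<partial>M) = 0"
    using assms(2,3) p_norm_powr[of p M f] by simp
  then have "AE x in M. norm (f x) powr p = 0"
    by (simp add: integral_nonneg_eq_0_iff_AE integrable_norm_powr[OF assms(1)])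
  then show ?thesis by eventually_elim simp
qed

lemma p_norm_le_iff:
  assumes "0 < p" "0 \<le> c"
  shows "p_norm M p f \<le> c \<longleftrightarrow> (\<integral>x. norm (f x) powr p \<partial>M) \<le> c powr p"
  using assms p_norm_nonneg[of M p f]
  by (metis less_le_not_le linorder_le_cases p_norm_powr powr_mono2 powr_less_mono2)

lemma p_norm_norm: "p_norm M p (\<lambda>x. norm (f x)) = p_norm M p f"
  by (simp add: p_norm_def)

lemma p_integrable_norm: "p_integrable M p f \<Longrightarrow> p_integrable M p (\<lambda>x. norm (f x))"
  by (auto simp: p_integrable_def)

lemma p_integrable_bound:
  assumes f: "p_integrable M p f" and g: "g \<in> borel_measurable M" and "0 \<le> p"
    and bound: "AE x in M. norm (g x) \<le> norm (f x)"
  shows "p_integrable M p g"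
  unfolding p_integrable_def
proof (intro conjI g Bochner_Integration.integrable_bound[OF integrable_norm_powr[OF f]])
  show "AE x in M. norm (norm (g x) powr p) \<le> norm (norm (f x) powr p)"
    using bound by eventually_elim (simp add: powr_mono2 \<open>0 \<le> p\<close>)
qed (use g in measurable)

lemma p_integrable_zero: "p_integrable M p (\<lambda>x. 0)"
  by (simp add: p_integrable_def)

lemma p_integrable_cmult:
  fixes f :: "'a \<Rightarrow> 'b::{second_countable_topology, real_normed_div_algebra}"
  shows "p_integrable M p f \<Longrightarrow> p_integrable M p (\<lambda>x. c * f x)"
  by (auto simp: p_integrable_def norm_mult powr_mult)

lemma p_norm_cmult:
  fixes f :: "'a \<Rightarrow> 'b::real_normed_div_algebra"
  assumes "0 < p"
  shows "p_norm M p (\<lambda>x. c * f x) = norm c * p_norm M p f"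
  using assms by (simp add: p_norm_def norm_mult powr_mult powr_powr)

lemma powr_convex_nonneg:
  assumes p: "1 \<le> p" shows "convex_on {0..} (\<lambda>x::real. x powr p)"
proof (rule convex_onI)
  fix t x y :: real
  assume t: "0 < t" "t < 1" and xy: "x \<in> {0..}" "y \<in> {0..}"
  have scaled: "(s * u) powr p \<le> s * u powr p" if "0 < s" "s < 1" "0 \<le> u" for s u
    using that p powr_mono'[of 1 p s] by (simp add: powr_mult mult_right_mono)
  show "((1 - t) *\<^sub>R x + t *\<^sub>R y) powr p \<le> (1 - t) * x powr p + t * y powr p"
  proof (cases "x = 0 \<or> y = 0")
    case True
    then show ?thesis using scaled[of t y] scaled[of "1 - t" x] t xy by auto
  next
    case False
    then show ?thesis using convex_onD[OF powr_convex[OF p], of t x y] t xy by simp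
  qed
qed simp

lemma powr_weighted_mean_le:
  fixes x y a b p :: real
  assumes "1 \<le> p" "0 \<le> x" "0 \<le> y" "0 < a" "0 < b"
  shows "((x + y) / (a + b)) powr p \<le> a / (a + b) * (x / a) powr p + b / (a + b) * (y / b) powr p"
proof -
  have weights: "1 - b / (a + b) = a / (a + b)" using assms by (simp add: field_simps)
  show ?thesis
    using convex_onD[OF powr_convex_nonneg[OF \<open>1 \<le> p\<close>], of "b / (a + b)" "x / a" "y / b"] assms
    by (simp add: weights add_divide_distrib)
qed

lemma p_integrable_add:
  assumes f: "p_integrable M p f" and g: "p_integrable M p g" and p: "1 \<le> p"
  shows "p_integrable M p (\<lambda>x. f x + g x)"
proof -
  note [measurable] = borel_measurable_p_integrable[OF f] borel_measurable_p_integrable[OF g]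
  have bound: "norm (f x + g x) powr p \<le> 2 powr p * ((norm (f x) powr p + norm (g x) powr p) / 2)" for x
  proof -
    have "norm (f x + g x) powr p \<le> (norm (f x) + norm (g x)) powr p"
      using p by (intro powr_mono2 norm_triangle_ineq) auto
    also have "\<dots> = 2 powr p * ((norm (f x) + norm (g x)) / 2) powr p"
      by (simp add: powr_divide)
    also have "\<dots> \<le> 2 powr p * ((norm (f x) powr p + norm (g x) powr p) / 2)"
      using powr_weighted_mean_le[OF p, of "norm (f x)" "norm (g x)" 1 1] by (intro mult_left_mono) auto
    finally show ?thesis .
  qed
  have "integrable M (\<lambda>x. norm (f x + g x) powr p)"
  proof (rule Bochner_Integration.integrable_bound)
    show "integrable M (\<lambda>x. 2 powr p * ((norm (f x) powr p + norm (g x) powr p) / 2))"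
      using integrable_norm_powr[OF f] integrable_norm_powr[OF g] by simp
    show "AE x in M. norm (norm (f x + g x) powr p)
        \<le> norm (2 powr p * ((norm (f x) powr p + norm (g x) powr p) / 2))"
      using bound by (auto intro: order_trans)
  qed simp
  then show ?thesis by (simp add: p_integrable_def)
qed

lemma p_integrable_diff:
  assumes "p_integrable M p f" "p_integrable M p g" "1 \<le> p"
  shows "p_integrable M p (\<lambda>x. f x - g x)"
proof -
  have "p_integrable M p (\<lambda>x. - g x)" using assms(2) by (simp add: p_integrable_def)
  then show ?thesis using p_integrable_add[OF assms(1) _ assms(3)] by fastforce
qed

lemma p_integrable_sum:
  assumes "\<And>i. i \<in> I \<Longrightarrow> p_integrable M p (f i)" "1 \<le> p"
  shows "p_integrable M p (\<lambda>x. \<Sum>i\<in>I. f i x)"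
  using assms
  by (induction I rule: infinite_finite_induct) (auto intro: p_integrable_add p_integrable_zero)

lemma Minkowski_inequality:
  assumes f: "p_integrable M p f" and g: "p_integrable M p g" and p: "1 \<le> p"
  shows "p_norm M p (\<lambda>x. f x + g x) \<le> p_norm M p f + p_norm M p g"
proof (rule field_le_epsilon)
  fix \<epsilon> :: real assume "0 < \<epsilon>"
  define a b where "a = p_norm M p f + \<epsilon> / 2" and "b = p_norm M p g + \<epsilon> / 2"
  have ab: "0 < a" "0 < b"
    using \<open>0 < \<epsilon>\<close> p_norm_nonneg[of M p f] p_norm_nonneg[of M p g] by (simp_all add: a_def b_def)
  have scaled: "(\<integral>x. (norm (h x) / c) powr p \<partial>M) \<le> 1" if "p_norm M p h \<le> c" "0 < c" for h :: "'a \<Rightarrow> 'b" and c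
    using that p p_norm_le_iff[of p c M h] by (simp add: powr_divide)
  have "(\<integral>x. (norm (f x + g x) / (a + b)) powr p \<partial>M)
      \<le> (\<integral>x. a / (a + b) * (norm (f x) / a) powr p + b / (a + b) * (norm (g x) / b) powr p \<partial>M)"
  proof (rule integral_mono)
    show "(norm (f x + g x) / (a + b)) powr p
        \<le> a / (a + b) * (norm (f x) / a) powr p + b / (a + b) * (norm (g x) / b) powr p" for x
    proof -
      have "(norm (f x + g x) / (a + b)) powr p \<le> ((norm (f x) + norm (g x)) / (a + b)) powr p"
        using ab p by (intro powr_mono2 divide_right_mono norm_triangle_ineq) auto
      also have "\<dots> \<le> a / (a + b) * (norm (f x) / a) powr p + b / (a + b) * (norm (g x) / b) powr p"
        using ab p by (intro powr_weighted_mean_le) auto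
      finally show ?thesis .
    qed
  qed (use ab integrable_norm_powr[OF f] integrable_norm_powr[OF g]
        integrable_norm_powr[OF p_integrable_add[OF f g p]] in \<open>simp_all add: powr_divide\<close>)
  also have "\<dots> = a / (a + b) * (\<integral>x. (norm (f x) / a) powr p \<partial>M)
      + b / (a + b) * (\<integral>x. (norm (g x) / b) powr p \<partial>M)"
    using ab integrable_norm_powr[OF f] integrable_norm_powr[OF g] by (simp add: powr_divide)
  also have "\<dots> \<le> a / (a + b) * 1 + b / (a + b) * 1"
    using ab \<open>0 < \<epsilon>\<close> by (intro add_mono mult_left_mono scaled) (auto simp: a_def b_def)
  also have "\<dots> = 1"
    using ab by (simp flip: add_divide_distrib)
  finally have "p_norm M p (\<lambda>x. f x + g x) \<le> a + b"
    using ab p by (simp add: p_norm_le_iff powr_divide)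
  then show "p_norm M p (\<lambda>x. f x + g x) \<le> p_norm M p f + p_norm M p g + \<epsilon>"
    by (simp add: a_def b_def)
qed

lemma p_norm_sum_le:
  assumes "\<And>i. i \<in> I \<Longrightarrow> p_integrable M p (f i)" "1 \<le> p"
  shows "p_norm M p (\<lambda>x. \<Sum>i\<in>I. f i x) \<le> (\<Sum>i\<in>I. p_norm M p (f i))"
  using assms(1)
proof (induction I rule: infinite_finite_induct)
  case (insert i I)
  then have "p_norm M p (\<lambda>x. f i x + (\<Sum>i\<in>I. f i x)) \<le> p_norm M p (f i) + p_norm M p (\<lambda>x. \<Sum>i\<in>I. f i x)"
    by (intro Minkowski_inequality p_integrable_sum assms(2)) auto
  then show ?case using insert by force
qed (simp_all add: p_norm_def)

lemma Beppo_Levi_upper_bound: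
  fixes u :: "nat \<Rightarrow> 'a \<Rightarrow> real"
  assumes u: "\<And>n. integrable M (u n)"
    and nonneg: "\<And>n x. 0 \<le> u n x" and mono: "\<And>m n x. m \<le> n \<Longrightarrow> u m x \<le> u n x"
    and bound: "\<And>n. (\<integral>x. u n x \<partial>M) \<le> C"
  obtains v where "integrable M v" "\<And>x. 0 \<le> v x" "AE x in M. \<forall>n. u n x \<le> v x"
proof -
  define U where "U x = (SUP n. ennreal (u n x))" for x
  have [measurable]: "U \<in> borel_measurable M"
    unfolding U_def using borel_measurable_integrable[OF u] by measurable
  have "(\<integral>\<^sup>+x. U x \<partial>M) = (SUP n. \<integral>\<^sup>+x. ennreal (u n x) \<partial>M)"
    unfolding U_def using borel_measurable_integrable[OF u]
    by (intro nn_integral_monotone_convergence_SUP) (auto intro!: incseq_SucI le_funI ennreal_leI mono)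
  also have "\<dots> \<le> ennreal C"
    using bound by (intro SUP_least) (simp add: nn_integral_eq_integral[OF u] nonneg ennreal_leI)
  finally have U_finite: "(\<integral>\<^sup>+x. U x \<partial>M) < \<infinity>"
    by (rule order.strict_trans1) simp
  have "(\<integral>\<^sup>+x. ennreal (norm (enn2real (U x))) \<partial>M) \<le> (\<integral>\<^sup>+x. U x \<partial>M)"
    by (intro nn_integral_mono) (simp add: ennreal_enn2real_if)
  then have integrable: "integrable M (\<lambda>x. enn2real (U x))"
    using U_finite by (intro integrableI_bounded) (auto intro: order.strict_trans1)
  have "AE x in M. U x \<noteq> \<infinity>"
    using U_finite by (intro nn_integral_PInf_AE) auto
  then have "AE x in M. \<forall>n. u n x \<le> enn2real (U x)"
  proof eventually_elim
    case (elim x)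
    have "ennreal (u n x) \<le> U x" for n unfolding U_def by (rule SUP_upper) simp
    then show ?case
      using elim enn2real_mono[of "ennreal (u _ x)" "U x"] nonneg by (simp add: less_top)
  qed
  with integrable show thesis by (intro that) auto
qed

lemma p_integrable_monotone_bound:
  fixes f :: "nat \<Rightarrow> 'a \<Rightarrow> real"
  assumes f: "\<And>n. p_integrable M p (f n)" and p: "0 < p"
    and nonneg: "\<And>n x. 0 \<le> f n x" and mono: "\<And>m n x. m \<le> n \<Longrightarrow> f m x \<le> f n x"
    and bound: "\<And>n. p_norm M p (f n) \<le> C"
  obtains g where "p_integrable M p g" "AE x in M. \<forall>n. f n x \<le> g x"
proof -
  have "0 \<le> C" using p_norm_nonneg bound[of 0] by (rule order_trans)
  have integral_le: "(\<integral>x. f n x powr p \<partial>M) \<le> C powr p" for n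
    using bound[of n] p \<open>0 \<le> C\<close> nonneg by (simp add: p_norm_le_iff)
  have integrable: "integrable M (\<lambda>x. f n x powr p)" for n
    using integrable_norm_powr[OF f[of n]] nonneg by simp
  obtain v where v: "integrable M v" "\<And>x. 0 \<le> v x" "AE x in M. \<forall>n. f n x powr p \<le> v x"
  proof (rule Beppo_Levi_upper_bound[OF integrable _ _ integral_le])
    show "f m x powr p \<le> f n x powr p" if "m \<le> n" for m n x
      using p nonneg mono[OF that] by (simp add: powr_mono2)
  qed auto
  show thesis
  proof (rule that[of "\<lambda>x. v x powr (1/p)"])
    show "p_integrable M p (\<lambda>x. v x powr (1/p))"
      using v(1,2) p borel_measurable_integrable[OF v(1)] by (simp add: p_integrable_def powr_powr)
    show "AE x in M. \<forall>n. f n x \<le> v x powr (1/p)"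
      using v(3)
    proof eventually_elim
      case (elim x)
      have "(f n x powr p) powr (1/p) \<le> v x powr (1/p)" for n
        using elim p by (intro powr_mono2) auto
      then show ?case using p nonneg by (simp add: powr_powr)
    qed
  qed
qed

section \<open>Hoelder's inequality and norming functionals\<close>

locale conjugate_exponents =
  fixes p q :: real
  assumes p_gt_1: "1 < p" and reciprocal_sum: "1/p + 1/q = 1"
begin

lemma q_gt_1: "1 < q"
proof -
  have "1/q = (p - 1)/p" using p_gt_1 reciprocal_sum by (simp add: field_simps)
  then have "q = p/(p - 1)" by (metis div_by_1 divide_divide_eq_right mult_1)
  then show ?thesis using p_gt_1 by simp
qed

lemma mult_q: "(p - 1) * q = p"
  using p_gt_1 q_gt_1 reciprocal_sum by (simp add: field_simps)

lemma integrable_mult_p_q: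
  fixes f g :: "'a \<Rightarrow> 'b::{second_countable_topology, banach, real_normed_algebra}"
  assumes f: "p_integrable M p f" and g: "p_integrable M q g"
  shows "integrable M (\<lambda>x. f x * g x)"
proof (rule Bochner_Integration.integrable_bound)
  note [measurable] = borel_measurable_p_integrable[OF f] borel_measurable_p_integrable[OF g]
  show "integrable M (\<lambda>x. norm (f x) powr p / p + norm (g x) powr q / q)"
    using integrable_norm_powr[OF f] integrable_norm_powr[OF g] by simp
  have "norm (f x * g x) \<le> norm (f x) powr p / p + norm (g x) powr q / q" for x
    using norm_mult_ineq[of "f x" "g x"]
      Youngs_inequality[OF p_gt_1 q_gt_1 reciprocal_sum norm_ge_zero norm_ge_zero] by (rule order_trans)
  then show "AE x in M. norm (f x * g x) \<le> norm (norm (f x) powr p / p + norm (g x) powr q / q)"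
    by (auto intro: order_trans[OF _ abs_ge_self])
  show "(\<lambda>x. f x * g x) \<in> borel_measurable M" by measurable
qed

lemma Holder_inequality:
  fixes f g :: "'a \<Rightarrow> 'b::{second_countable_topology, banach, real_normed_algebra}"
  assumes f: "p_integrable M p f" and g: "p_integrable M q g"
  shows "norm (\<integral>x. f x * g x \<partial>M) \<le> p_norm M p f * p_norm M q g"
proof (cases "p_norm M p f = 0 \<or> p_norm M q g = 0")
  case True
  then have "(AE x in M. f x = 0) \<or> (AE x in M. g x = 0)"
    using p_gt_1 q_gt_1 p_norm_eq_0_imp_AE[OF f] p_norm_eq_0_imp_AE[OF g] by auto
  then have "AE x in M. f x * g x = 0" by auto
  then have "(\<integral>x. f x * g x \<partial>M) = 0" by (rule integral_eq_zero_AE)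
  then show ?thesis using True by auto
next
  case False
  define a b where "a = p_norm M p f" and "b = p_norm M q g"
  have ab: "0 < a" "0 < b" using False p_norm_nonneg by (auto simp: a_def b_def less_le)
  have "norm (\<integral>x. f x * g x \<partial>M) \<le> (\<integral>x. norm (f x * g x) \<partial>M)"
    by (rule integral_norm_bound)
  also have "\<dots> \<le> (\<integral>x. a * b * ((norm (f x) / a) powr p / p + (norm (g x) / b) powr q / q) \<partial>M)"
  proof (rule integral_mono)
    show "norm (f x * g x) \<le> a * b * ((norm (f x) / a) powr p / p + (norm (g x) / b) powr q / q)" for x
    proof -
      have "norm (f x * g x) \<le> a * b * (norm (f x) / a * (norm (g x) / b))"
        using ab norm_mult_ineq by simp
      also have "\<dots> \<le> a * b * ((norm (f x) / a) powr p / p + (norm (g x) / b) powr q / q)"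
        using ab p_gt_1 q_gt_1 reciprocal_sum by (intro mult_left_mono Youngs_inequality) auto
      finally show ?thesis .
    qed
  qed (use ab f g in \<open>auto intro: integrable_mult_p_q simp: powr_divide integrable_norm_powr\<close>)
  also have "\<dots> = a * b * ((\<integral>x. norm (f x) powr p \<partial>M) / a powr p / p
      + (\<integral>x. norm (g x) powr q \<partial>M) / b powr q / q)"
    using ab by (simp add: powr_divide integrable_norm_powr f g)
  also have "\<dots> = a * b * (1/p + 1/q)"
    using ab p_gt_1 q_gt_1 by (simp add: p_norm_powr[symmetric] flip: a_def b_def)
  finally show ?thesis by (simp add: reciprocal_sum a_def b_def)
qed

end

lemma conjugate_exponents_divide_pred: "1 < p \<Longrightarrow> conjugate_exponents p (p / (p - 1))"
  by unfold_locales (simp_all add: divide_simps)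

text \<open>The derivative of \<open>\<bar>x\<bar>\<^sup>p / p\<close>; composition with it is the duality map from \<open>L\<^sup>p\<close> to \<open>L\<^sup>q\<close>.\<close>
definition dual_power :: "real \<Rightarrow> complex \<Rightarrow> complex" where
  "dual_power p x = cnj x * of_real (norm x powr (p - 2))"

lemma dual_power_zero: "dual_power p 0 = 0"
  by (simp add: dual_power_def)

lemma norm_dual_power: "norm (dual_power p x) = norm x powr (p - 1)"
  by (cases "x = 0") (simp_all add: dual_power_def norm_mult powr_mult_base)

lemma mult_dual_power: "x * dual_power p x = of_real (norm x powr p)"
proof (cases "x = 0")
  case False
  have "x * dual_power p x = of_real ((norm x)\<^sup>2 * norm x powr (p - 2))"
    by (simp add: dual_power_def complex_norm_square[symmetric] mult.assoc[symmetric])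
  also have "(norm x)\<^sup>2 * norm x powr (p - 2) = norm x powr p"
    using False by (simp add: powr_diff)
  finally show ?thesis .
qed (simp add: dual_power_zero)

lemma dual_power_mult: "dual_power p (x * y) = dual_power p x * dual_power p y"
  by (simp add: dual_power_def norm_mult powr_mult)

lemma isCont_dual_power:
  assumes "1 < p" shows "isCont (dual_power p) x"
proof (cases "x = 0")
  case True
  have "((\<lambda>y. norm (dual_power p y)) \<longlongrightarrow> norm (0::complex) powr (p - 1)) (at 0)"
    unfolding norm_dual_power using assms by (intro tendsto_powr' tendsto_intros) auto
  then show ?thesis
    using True by (simp add: isCont_def tendsto_norm_zero_iff dual_power_zero)
next
  case False
  then show ?thesis unfolding dual_power_def by (intro continuous_intros) auto
qed

lemma borel_measurable_dual_power: "1 < p \<Longrightarrow> dual_power p \<in> borel_measurable borel"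
  by (simp add: borel_measurable_continuous_onI continuous_at_imp_continuous_on isCont_dual_power)

lemma (in conjugate_exponents)
  assumes e: "p_integrable M p e"
  shows p_integrable_dual_power: "p_integrable M q (\<lambda>x. dual_power p (e x))"
    and p_norm_dual_power: "p_norm M q (\<lambda>x. dual_power p (e x)) = p_norm M p e powr (p - 1)"
proof -
  note [measurable] = borel_measurable_p_integrable[OF e] borel_measurable_dual_power[OF p_gt_1]
  have powr_q: "norm (dual_power p (e x)) powr q = norm (e x) powr p" for x
    by (simp add: norm_dual_power powr_powr mult_q)
  show "p_integrable M q (\<lambda>x. dual_power p (e x))"
    using integrable_norm_powr[OF e] by (simp add: p_integrable_def powr_q)
  have "p_norm M q (\<lambda>x. dual_power p (e x)) = (p_norm M p e powr p) powr (1/q)"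
    using p_gt_1 by (simp add: p_norm_powr powr_q) (simp add: p_norm_def powr_q)
  also have "p * (1/q) = p - 1"
    using q_gt_1 mult_q by (simp add: field_simps)
  then have "(p_norm M p e powr p) powr (1/q) = p_norm M p e powr (p - 1)"
    by (simp add: powr_powr)
  finally show "p_norm M q (\<lambda>x. dual_power p (e x)) = p_norm M p e powr (p - 1)" .
qed

context
  fixes M :: "'a measure" and p :: real and e :: "'a \<Rightarrow> complex"
  assumes p_gt_1: "1 < p" and e: "p_integrable M p e"
begin

interpretation conjugate_exponents p "p / (p - 1)"
  using p_gt_1 by (simp add: conjugate_exponents_divide_pred)

lemma integrable_mult_dual_power:
  "p_integrable M p f \<Longrightarrow> integrable M (\<lambda>x. f x * dual_power p (e x))"
  by (intro integrable_mult_p_q p_integrable_dual_power e)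

lemma norm_integral_mult_dual_power_le:
  assumes "p_integrable M p f"
  shows "norm (\<integral>x. f x * dual_power p (e x) \<partial>M) \<le> p_norm M p f * p_norm M p e powr (p - 1)"
  using Holder_inequality[OF assms p_integrable_dual_power[OF e]] by (simp add: p_norm_dual_power e)

end

lemma integral_self_mult_dual_power:
  assumes "0 < p" shows "(\<integral>x. e x * dual_power p (e x) \<partial>M) = of_real (p_norm M p e powr p)"
  using assms by (simp add: mult_dual_power p_norm_powr)

definition norming_functional :: "'a measure \<Rightarrow> real \<Rightarrow> ('a \<Rightarrow> complex) \<Rightarrow> ('a \<Rightarrow> complex) \<Rightarrow> complex" where
  "norming_functional M p e f = (\<integral>x. f x * dual_power p (e x) \<partial>M) / of_real (p_norm M p e powr p)"

lemma norming_functional_self: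
  assumes "0 < p" "0 < p_norm M p e" shows "norming_functional M p e e = 1"
  using assms by (simp add: norming_functional_def integral_self_mult_dual_power)

lemma norming_functional_cmult: "norming_functional M p e (\<lambda>x. c * f x) = c * norming_functional M p e f"
  by (simp add: norming_functional_def mult.assoc)

lemma norming_functional_add:
  assumes "1 < p" "p_integrable M p e" "p_integrable M p f" "p_integrable M p g"
  shows "norming_functional M p e (\<lambda>x. f x + g x) = norming_functional M p e f + norming_functional M p e g"
  using assms
  by (simp add: norming_functional_def distrib_right integrable_mult_dual_power add_divide_distrib)

lemma norming_functional_diff:
  assumes "1 < p" "p_integrable M p e" "p_integrable M p f" "p_integrable M p g"
  shows "norming_functional M p e (\<lambda>x. f x - g x) = norming_functional M p e f - norming_functional M p e g"
  using assms
  by (simp add: norming_functional_def left_diff_distrib integrable_mult_dual_power diff_divide_distrib)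

lemma norming_functional_sum:
  assumes "1 < p" "p_integrable M p e" "\<And>i. i \<in> I \<Longrightarrow> p_integrable M p (f i)"
  shows "norming_functional M p e (\<lambda>x. \<Sum>i\<in>I. f i x) = (\<Sum>i\<in>I. norming_functional M p e (f i))"
  using assms
  by (simp add: norming_functional_def sum_distrib_right integrable_mult_dual_power sum_divide_distrib)

lemma norm_norming_functional_le:
  assumes "1 < p" "p_integrable M p e" "p_integrable M p f"
  shows "norm (norming_functional M p e f) \<le> p_norm M p f / p_norm M p e"
proof -
  have "norm (norming_functional M p e f) \<le> p_norm M p f * p_norm M p e powr (p - 1) / p_norm M p e powr p"
    unfolding norming_functional_def
    using norm_integral_mult_dual_power_le[OF assms] by (simp add: norm_divide divide_right_mono)
  also have "\<dots> = p_norm M p f / p_norm M p e"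
    using p_norm_nonneg[of M p e] by (cases "p_norm M p e = 0") (simp_all add: powr_diff)
  finally show ?thesis .
qed

lemma tendsto_integral_mult_dual_power:
  fixes s :: "nat \<Rightarrow> complex"
  assumes p: "1 < p" and e: "p_integrable M p e" and h: "p_integrable M p h"
    and s: "s \<longlonglongrightarrow> 0" "\<And>n. norm (s n) \<le> 1"
  shows "(\<lambda>n. \<integral>x. h x * dual_power p (e x + s n * h x) \<partial>M) \<longlonglongrightarrow> (\<integral>x. h x * dual_power p (e x) \<partial>M)"
proof -
  note [measurable] = borel_measurable_p_integrable[OF e] borel_measurable_p_integrable[OF h]
    borel_measurable_dual_power[OF p]
  define w where "w x = norm (h x * dual_power p (of_real (norm (e x) + norm (h x))))" for x
  show ?thesis
  proof (rule integral_dominated_convergence[where w = w])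
    have "p_integrable M p (\<lambda>x. norm (e x) + norm (h x))"
      using p by (intro p_integrable_add p_integrable_norm e h) auto
    then have "p_integrable M p (\<lambda>x. complex_of_real (norm (e x) + norm (h x)))"
      by (auto simp: p_integrable_def simp del: of_real_add)
    then show "integrable M w"
      unfolding w_def by (intro integrable_norm integrable_mult_dual_power p h)
    have "(\<lambda>n. e x + s n * h x) \<longlonglongrightarrow> e x" for x
      using tendsto_add[OF tendsto_const tendsto_mult_left_zero[OF s(1)], of "e x" "h x"] by simp
    then show "AE x in M. (\<lambda>n. h x * dual_power p (e x + s n * h x)) \<longlonglongrightarrow> h x * dual_power p (e x)"
      by (intro AE_I2 tendsto_mult tendsto_const isCont_tendsto_compose[OF isCont_dual_power[OF p]])
    show "AE x in M. norm (h x * dual_power p (e x + s n * h x)) \<le> w x" for n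
    proof (intro AE_I2)
      fix x
      have "norm (e x + s n * h x) \<le> norm (e x) + norm (h x)"
        using norm_triangle_ineq[of "e x" "s n * h x"]
          mult_left_le_one_le[of "norm (h x)" "norm (s n)"] s(2)[of n] by (simp add: norm_mult)
      then show "norm (h x * dual_power p (e x + s n * h x)) \<le> w x"
        unfolding w_def norm_mult norm_dual_power using p
        by (intro mult_left_mono powr_mono2) (simp_all del: of_real_add)
    qed
  qed measurable
qed

text \<open>\<open>\<parallel>e + s h\<parallel>\<^sup>p = \<langle>e + s h, J(e + s h)\<rangle> \<le> \<parallel>e\<parallel> \<parallel>e + s h\<parallel>\<^sup>p\<^sup>-\<^sup>1 + s Re \<langle>h, J(e + s h)\<rangle>\<close>
  for the duality map \<open>J\<close>.\<close>
lemma norm_growth_le_Re_dual_pairing: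
  fixes s \<kappa> :: real
  assumes p: "1 < p" and e: "p_integrable M p e" and h: "p_integrable M p h" and s: "0 < s" and \<kappa>: "0 \<le> \<kappa>"
    and growth: "(1 + s * \<kappa>) * p_norm M p e \<le> p_norm M p (\<lambda>x. e x + of_real s * h x)"
  shows "\<kappa> * p_norm M p e powr p \<le> Re (\<integral>x. h x * dual_power p (e x + of_real s * h x) \<partial>M)"
proof -
  define g where "g x = e x + of_real s * h x" for x
  define a b where "a = p_norm M p e" and "b = p_norm M p g"
  define H where "H = Re (\<integral>x. h x * dual_power p (g x) \<partial>M)"
  have g: "p_integrable M p g"
    unfolding g_def using p by (intro p_integrable_add p_integrable_cmult e h) auto
  have a: "0 \<le> a" "a \<le> b" "s * \<kappa> * a \<le> b - a"
    using growth s \<kappa> p_norm_nonneg[of M p e] unfolding a_def b_def g_def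
    by (auto simp: algebra_simps intro: order_trans[rotated] add_increasing)
  have "b powr p = Re (\<integral>x. g x * dual_power p (g x) \<partial>M)"
    using p by (simp add: integral_self_mult_dual_power b_def)
  also have "\<dots> = Re (\<integral>x. e x * dual_power p (g x) \<partial>M) + s * H"
    unfolding H_def using integrable_mult_dual_power[OF p g e] integrable_mult_dual_power[OF p g h]
    by (subst (1) g_def) (simp add: distrib_right mult.assoc)
  also have "\<dots> \<le> a * b powr (p - 1) + s * H"
    using norm_integral_mult_dual_power_le[OF p g e]
    by (auto simp: a_def b_def intro: order_trans[OF complex_Re_le_cmod])
  finally have "(b - a) * b powr (p - 1) \<le> s * H"
    using a powr_mult_base[of b "p - 1"] by (simp add: left_diff_distrib)
  moreover have "s * \<kappa> * a * a powr (p - 1) \<le> (b - a) * b powr (p - 1)"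
    using a s \<kappa> p by (intro mult_mono powr_mono2) auto
  ultimately have "s * (\<kappa> * a powr p) \<le> s * H"
    using a powr_mult_base[of a "p - 1"] by (simp add: mult.assoc)
  then show ?thesis using s by (simp add: a_def H_def g_def)
qed

context
  fixes M :: "'a measure" and p :: real and e :: "'a \<Rightarrow> complex" and \<Phi> :: "('a \<Rightarrow> complex) \<Rightarrow> complex"
  assumes p: "1 < p" and e: "p_integrable M p e" and pos: "0 < p_norm M p e" and one: "\<Phi> e = 1"
    and add: "\<And>f g. p_integrable M p f \<Longrightarrow> p_integrable M p g \<Longrightarrow> \<Phi> (\<lambda>x. f x + g x) = \<Phi> f + \<Phi> g"
    and cmult: "\<And>f c. p_integrable M p f \<Longrightarrow> \<Phi> (\<lambda>x. c * f x) = c * \<Phi> f"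
    and bound: "\<And>f. p_integrable M p f \<Longrightarrow> norm (\<Phi> f) \<le> p_norm M p f / p_norm M p e"
begin

lemma norming_functional_zero_imp_nonpos:
  assumes h: "p_integrable M p h" and zero: "norming_functional M p e h = 0"
    and \<kappa>: "\<Phi> h = of_real \<kappa>"
  shows "\<kappa> \<le> 0"
proof (rule ccontr)
  assume "\<not> \<kappa> \<le> 0"
  define s where "s n = inverse (real (Suc n))" for n
  have s: "0 < s n" "s n \<le> 1" for n by (simp_all add: s_def inverse_le_1_iff)
  have "\<kappa> * p_norm M p e powr p \<le> Re (\<integral>x. h x * dual_power p (e x + of_real (s n) * h x) \<partial>M)" for n
  proof (rule norm_growth_le_Re_dual_pairing[OF p e h s(1)])
    have "p_integrable M p (\<lambda>x. e x + of_real (s n) * h x)"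
      using p by (intro p_integrable_add p_integrable_cmult e h) auto
    moreover have "\<Phi> (\<lambda>x. e x + of_real (s n) * h x) = of_real (1 + s n * \<kappa>)"
      by (simp add: add cmult p_integrable_cmult e h one \<kappa>)
    ultimately have "\<bar>1 + s n * \<kappa>\<bar> \<le> p_norm M p (\<lambda>x. e x + of_real (s n) * h x) / p_norm M p e"
      using bound by (metis norm_of_real)
    then have "1 + s n * \<kappa> \<le> p_norm M p (\<lambda>x. e x + of_real (s n) * h x) / p_norm M p e"
      by (rule abs_le_D1)
    then show "(1 + s n * \<kappa>) * p_norm M p e \<le> p_norm M p (\<lambda>x. e x + of_real (s n) * h x)"
      using pos by (simp add: pos_le_divide_eq)
  qed (use \<open>\<not> \<kappa> \<le> 0\<close> in simp)
  moreover have "(\<integral>x. h x * dual_power p (e x) \<partial>M) = 0"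
    using zero pos by (simp add: norming_functional_def)
  moreover have "s \<longlonglongrightarrow> 0"
    unfolding s_def by (rule LIMSEQ_inverse_real_of_nat)
  then have "(\<lambda>n. complex_of_real (s n)) \<longlonglongrightarrow> 0"
    using tendsto_of_real by fastforce
  then have "(\<lambda>n. \<integral>x. h x * dual_power p (e x + of_real (s n) * h x) \<partial>M)
      \<longlonglongrightarrow> (\<integral>x. h x * dual_power p (e x) \<partial>M)"
    using s by (intro tendsto_integral_mult_dual_power p e h) (auto simp: less_imp_le)
  ultimately have "\<kappa> * p_norm M p e powr p \<le> Re 0"
    by (intro LIMSEQ_le_const[OF tendsto_Re]) auto
  then show False using pos \<open>\<not> \<kappa> \<le> 0\<close> by (simp add: mult_le_0_iff)
qed

lemma norming_functional_unique:
  assumes f: "p_integrable M p f"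
  shows "\<Phi> f = norming_functional M p e f"
proof -
  let ?L = "norming_functional M p e"
  define k where "k x = f x + (- ?L f) * e x" for x
  have k: "p_integrable M p k"
    unfolding k_def using p by (intro p_integrable_add p_integrable_cmult f e) auto
  have "?L k = ?L f + (- ?L f) * ?L e"
    unfolding k_def using p
    by (simp only: norming_functional_add p_integrable_cmult norming_functional_cmult f e)
  then have L_k: "?L k = 0"
    using p pos by (simp add: norming_functional_self)
  have \<Phi>_k: "\<Phi> k = \<Phi> f - ?L f"
    unfolding k_def by (simp only: add cmult p_integrable_cmult f e one) simp
  have "?L (\<lambda>x. cnj (\<Phi> k) * k x) = 0"
    by (simp add: norming_functional_cmult L_k)
  moreover have "\<Phi> (\<lambda>x. cnj (\<Phi> k) * k x) = of_real ((norm (\<Phi> k))\<^sup>2)"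
    unfolding cmult[OF k] by (metis complex_norm_square mult.commute)
  ultimately have "(norm (\<Phi> k))\<^sup>2 \<le> 0"
    by (rule norming_functional_zero_imp_nonpos[OF p_integrable_cmult[OF k]])
  then show ?thesis using \<Phi>_k by simp
qed

end

section \<open>Monomials and the action of the torus\<close>

text \<open>The torus acts by the componentwise multiplication of vectors.\<close>
definition torus :: "(complex^'n) set" where
  "torus = {u. \<forall>j. norm (u$j) = 1}"

lemma one_in_torus: "1 \<in> torus"
  by (simp add: torus_def)

lemma torus_mult: "u \<in> torus \<Longrightarrow> v \<in> torus \<Longrightarrow> u * v \<in> torus"
  by (simp add: torus_def norm_mult)

lemma torus_inverse:
  assumes "u \<in> torus"
  obtains v where "v \<in> torus" "v * u = 1"
proof
  show "(\<chi> j. inverse (u$j)) \<in> torus"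
    using assms by (simp add: torus_def norm_inverse)
  have "u$j \<noteq> 0" for j using assms by (auto simp: torus_def dest: spec[of _ j])
  then show "(\<chi> j. inverse (u$j)) * u = 1"
    by (simp add: vec_eq_iff)
qed

lemma orthogonal_transformation_torus:
  assumes "u \<in> torus" shows "orthogonal_transformation ((*) u)"
  unfolding orthogonal_transformation
  using assms by (auto intro!: linearI simp: torus_def norm_vec_def norm_mult distrib_left)

lemma monom_one: "monom \<alpha> 1 = 1"
  by (simp add: monom_def)

lemma monom_mult: "monom \<alpha> (u * z) = monom \<alpha> u * monom \<alpha> z"
  by (simp add: monom_def power_int_mult_distrib prod.distrib)

lemma norm_monom: "norm (monom \<alpha> z) = (\<Prod>j\<in>UNIV. norm (z$j) powi \<alpha> j)"
  by (simp add: monom_def prod_norm[symmetric] norm_power_int)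

lemma norm_monom_torus: "u \<in> torus \<Longrightarrow> norm (monom \<alpha> u) = 1"
  by (simp add: norm_monom torus_def)

lemma monom_nonzero: "(\<And>j. z$j \<noteq> 0) \<Longrightarrow> monom \<alpha> z \<noteq> 0"
  by (simp add: monom_def)

lemma borel_measurable_monom: "monom \<alpha> \<in> borel_measurable borel"
proof -
  have [measurable]: "(\<lambda>z::complex^'n. z$j) \<in> borel_measurable borel" for j
    by (intro borel_measurable_continuous_onI continuous_intros)
  have [measurable]: "(\<lambda>z::complex^'n. (z$j) powi k) \<in> borel_measurable borel" for j k
    unfolding power_int_def by (cases "0 \<le> k") simp_all
  show ?thesis unfolding monom_def by measurable
qed

lemma torus_separates_monomials:
  fixes \<alpha> \<beta> :: "'n::finite \<Rightarrow> int"
  assumes "\<alpha> \<noteq> \<beta>"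
  obtains u :: "complex^'n" where "u \<in> torus" "monom \<alpha> u = - monom \<beta> u"
proof -
  obtain j where j: "\<alpha> j \<noteq> \<beta> j" using assms by auto
  define c where "c = cis (pi / of_int (\<alpha> j - \<beta> j))"
  define u :: "complex^'n" where "u = (\<chi> i. if i = j then c else 1)"
  have monom_u: "monom \<gamma> u = c powi \<gamma> j" for \<gamma>
  proof -
    have "monom \<gamma> u = (\<Prod>i\<in>UNIV. if i = j then c powi \<gamma> i else 1)"
      unfolding monom_def u_def by (intro prod.cong) auto
    then show ?thesis by simp
  qed
  have "c powi (\<alpha> j - \<beta> j) = -1"
    using j by (simp add: c_def cis_power_int)
  moreover have "c \<noteq> 0" by (simp add: c_def)
  ultimately have "monom \<alpha> u = - monom \<beta> u"
    by (simp add: monom_u power_int_diff nonzero_divide_eq_eq)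
  moreover have "u \<in> torus" by (simp add: torus_def u_def c_def)
  ultimately show thesis by (rule that[rotated])
qed

definition torus_invariant :: "(complex^'n) measure \<Rightarrow> bool" where
  "torus_invariant M \<longleftrightarrow> (\<forall>u\<in>torus. (*) u \<in> M \<rightarrow>\<^sub>M M \<and> distr M M ((*) u) = M)"

lemma torus_invariant_lebesgue: "torus_invariant lebesgue"
  unfolding torus_invariant_def
  by (simp add: orthogonal_transformation_torus measurable_lebesgue_orthogonal_transformation
      distr_lebesgue_orthogonal_transformation)

lemma torus_invariant_density:
  assumes M: "torus_invariant M" and h: "h \<in> borel_measurable M"
    and invariant: "\<And>u z. u \<in> torus \<Longrightarrow> h (u * z) = h z"
  shows "torus_invariant (density M h)"
  unfolding torus_invariant_def
proof (intro ballI conjI)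
  fix u :: "complex^'a" assume u: "u \<in> torus"
  then have T: "(*) u \<in> M \<rightarrow>\<^sub>M M" "distr M M ((*) u) = M"
    using M by (auto simp: torus_invariant_def)
  then show "(*) u \<in> density M h \<rightarrow>\<^sub>M density M h" by simp
  have "density M h = density (distr M M ((*) u)) h"
    using T by simp
  also have "\<dots> = distr (density M h) M ((*) u)"
    using density_distr[OF h T(1)] by (simp add: invariant[OF u])
  also have "\<dots> = distr (density M h) (density M h) ((*) u)"
    by (rule distr_cong) auto
  finally show "distr (density M h) (density M h) ((*) u) = density M h" ..
qed

lemma integral_monom_dual_power_eq_0:
  assumes M: "torus_invariant M" and "\<alpha> \<noteq> \<beta>"
  shows "(\<integral>z. monom \<beta> z * dual_power p (monom \<alpha> z) \<partial>M) = 0"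
proof (cases "integrable M (\<lambda>z. monom \<beta> z * dual_power p (monom \<alpha> z))")
  case True
  define F where "F z = monom \<beta> z * dual_power p (monom \<alpha> z)" for z
  obtain u :: "complex^'a" where u: "u \<in> torus" "monom \<alpha> u = - monom \<beta> u"
    using torus_separates_monomials[OF \<open>\<alpha> \<noteq> \<beta>\<close>] .
  have "monom \<beta> u * dual_power p (monom \<alpha> u) = - (monom \<alpha> u * dual_power p (monom \<alpha> u))"
    by (simp add: u(2))
  then have "monom \<beta> u * dual_power p (monom \<alpha> u) = -1"
    using norm_monom_torus[OF u(1)] by (simp add: mult_dual_power)
  moreover have "F (u * z) = monom \<beta> u * dual_power p (monom \<alpha> u) * F z" for z
    by (simp add: F_def monom_mult dual_power_mult mult_ac)
  ultimately have rotate: "F (u * z) = - F z" for z by simp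
  have "(\<integral>z. F z \<partial>M) = (\<integral>z. F z \<partial>distr M M ((*) u))"
    using M u(1) by (simp add: torus_invariant_def)
  also have "\<dots> = (\<integral>z. F (u * z) \<partial>M)"
    using M u(1) True unfolding F_def by (intro integral_distr) (auto simp: torus_invariant_def)
  also have "\<dots> = - (\<integral>z. F z \<partial>M)"
    by (simp add: rotate)
  finally show ?thesis
    by (simp add: F_def eq_neg_iff_add_eq_0 flip: mult_2)
qed (rule not_integrable_integral_eq)

text \<open>Rotations that tell two monomials apart allow to average away all coefficients but one of a
  series that vanishes on the torus.\<close>
lemma torus_half_turn_average:
  fixes d :: "('n::finite \<Rightarrow> int) \<Rightarrow> complex"
  assumes "\<beta> \<noteq> \<gamma>" and zero: "\<And>u. u \<in> torus \<Longrightarrow> ((\<lambda>\<alpha>. d \<alpha> * monom \<alpha> u) has_sum 0) UNIV"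
  obtains d' where "d' \<beta> = d \<beta>" "d' \<gamma> = 0" "\<And>\<alpha>. norm (d' \<alpha>) \<le> norm (d \<alpha>)"
    "\<And>u. u \<in> torus \<Longrightarrow> ((\<lambda>\<alpha>. d' \<alpha> * monom \<alpha> u) has_sum 0) UNIV"
proof -
  obtain u :: "complex^'n" where u: "u \<in> torus" "monom \<gamma> u = - monom \<beta> u"
    using torus_separates_monomials[of \<gamma> \<beta>] \<open>\<beta> \<noteq> \<gamma>\<close> by auto
  define d' where "d' \<alpha> = (d \<alpha> + d \<alpha> * monom \<alpha> u / monom \<beta> u) / 2" for \<alpha>
  show thesis
  proof (rule that[of d'])
    show "d' \<beta> = d \<beta>" "d' \<gamma> = 0"
      using norm_monom_torus[OF u(1), of \<beta>] by (auto simp: d'_def u(2))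
    show "norm (d' \<alpha>) \<le> norm (d \<alpha>)" for \<alpha>
      using norm_triangle_ineq[of "d \<alpha>" "d \<alpha> * monom \<alpha> u / monom \<beta> u"]
      by (simp add: d'_def norm_divide norm_mult norm_monom_torus[OF u(1)])
    fix v :: "complex^'n" assume v: "v \<in> torus"
    have "((\<lambda>\<alpha>. (d \<alpha> * monom \<alpha> v + d \<alpha> * monom \<alpha> (u * v) / monom \<beta> u) / 2)
        has_sum (0 + 0 / monom \<beta> u) / 2) UNIV"
      by (intro has_sum_divide_const has_sum_add zero torus_mult u(1) v)
    then show "((\<lambda>\<alpha>. d' \<alpha> * monom \<alpha> v) has_sum 0) UNIV"
      by (simp add: d'_def monom_mult field_simps)
  qed
qed

lemma norm_coeff_le_infsum_others:
  fixes d :: "('n::finite \<Rightarrow> int) \<Rightarrow> complex"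
  assumes "finite F" "\<beta> \<notin> F" "\<And>u. u \<in> torus \<Longrightarrow> ((\<lambda>\<alpha>. d \<alpha> * monom \<alpha> u) has_sum 0) UNIV"
    and "(\<lambda>\<alpha>. norm (d \<alpha>)) summable_on UNIV"
  shows "norm (d \<beta>) \<le> (\<Sum>\<^sub>\<infinity>\<alpha>\<in>- insert \<beta> F. norm (d \<alpha>))"
  using assms
proof (induction F arbitrary: d rule: finite_induct)
  case empty
  have summable: "(\<lambda>\<alpha>. norm (d \<alpha>)) summable_on -{\<beta>}"
    using empty.prems(3) by (rule summable_on_subset) simp
  have "insert \<beta> (-{\<beta>}) = UNIV" by auto
  then have "infsum d (insert \<beta> (-{\<beta>})) = 0"
    using empty.prems(2)[OF one_in_torus] by (simp add: monom_one infsumI)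
  then have "d \<beta> = - infsum d (-{\<beta>})"
    using infsum_insert[OF abs_summable_summable[OF summable], of \<beta>] by (simp add: eq_neg_iff_add_eq_0)
  then show ?case using norm_infsum_bound[OF summable] by simp
next
  case (insert \<gamma> F)
  obtain d' where d': "d' \<beta> = d \<beta>" "d' \<gamma> = 0" "\<And>\<alpha>. norm (d' \<alpha>) \<le> norm (d \<alpha>)"
      "\<And>u. u \<in> torus \<Longrightarrow> ((\<lambda>\<alpha>. d' \<alpha> * monom \<alpha> u) has_sum 0) UNIV"
    using torus_half_turn_average[of \<beta> \<gamma> d] insert.prems(1,2) by auto
  have summable: "(\<lambda>\<alpha>. norm (d' \<alpha>)) summable_on UNIV"
    using insert.prems(3) d'(3) by (rule summable_on_comparison_test) auto
  have "norm (d' \<beta>) \<le> (\<Sum>\<^sub>\<infinity>\<alpha>\<in>- insert \<beta> F. norm (d' \<alpha>))"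
    using insert.prems(1) d'(4) summable by (intro insert.IH) auto
  also have "\<dots> \<le> (\<Sum>\<^sub>\<infinity>\<alpha>\<in>- insert \<beta> (insert \<gamma> F). norm (d \<alpha>))"
    using summable_on_subset[OF summable] summable_on_subset[OF insert.prems(3)] d'(2,3)
    by (intro infsum_mono_neutral) auto
  finally show ?case by (simp add: d'(1))
qed

lemma torus_series_coeff_eq_0:
  fixes d :: "('n::finite \<Rightarrow> int) \<Rightarrow> complex"
  assumes zero: "\<And>u. u \<in> torus \<Longrightarrow> ((\<lambda>\<alpha>. d \<alpha> * monom \<alpha> u) has_sum 0) UNIV"
  shows "d \<beta> = 0"
proof -
  have "d summable_on UNIV"
    using zero[OF one_in_torus] by (auto simp: monom_one summable_on_def)
  then have summable: "(\<lambda>\<alpha>. norm (d \<alpha>)) summable_on A" for A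
    using summable_on_iff_abs_summable_on_complex summable_on_subset by blast
  define t where "t = (\<Sum>\<^sub>\<infinity>\<alpha>\<in>-{\<beta>}. norm (d \<alpha>))"
  have "(\<Sum>\<alpha>\<in>F. norm (d \<alpha>)) \<le> t - norm (d \<beta>)" if "finite F" "F \<subseteq> -{\<beta>}" for F
  proof -
    have "- insert \<beta> F \<union> F = -{\<beta>}" "- insert \<beta> F \<inter> F = {}" using that by auto
    then have "t = (\<Sum>\<^sub>\<infinity>\<alpha>\<in>- insert \<beta> F. norm (d \<alpha>)) + (\<Sum>\<alpha>\<in>F. norm (d \<alpha>))"
      using infsum_Un_disjoint[OF summable summable, of "- insert \<beta> F" F] that(1) by (simp add: t_def)
    moreover have "norm (d \<beta>) \<le> (\<Sum>\<^sub>\<infinity>\<alpha>\<in>- insert \<beta> F. norm (d \<alpha>))"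
      using that zero summable by (intro norm_coeff_le_infsum_others) auto
    ultimately show ?thesis by simp
  qed
  then have "t \<le> t - norm (d \<beta>)"
    unfolding t_def by (intro infsum_le_finite_sums summable)
  then show ?thesis by simp
qed

section \<open>Reinhardt domains\<close>

lemma reinhardt_torus:
  assumes "reinhardt \<Omega>" "u \<in> torus" "z \<in> \<Omega>"
  shows "u * z \<in> \<Omega>"
proof -
  have "norm (u$j) = 1" for j
    using assms(2) by (simp add: torus_def)
  then have "exp (\<i> * of_real (Arg (u$j))) = u$j" for j
    using Arg_eq[of "u$j"] by (metis mult_1 norm_zero of_real_1 zero_neq_one)
  then have "u * z = (\<chi> j. exp (\<i> * of_real (Arg (u$j))) * z$j)"
    by (simp add: vec_eq_iff)
  then show ?thesis using assms by (simp add: reinhardt_def)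
qed

lemma reinhardt_torus_iff:
  assumes "reinhardt \<Omega>" "u \<in> torus"
  shows "u * z \<in> \<Omega> \<longleftrightarrow> z \<in> \<Omega>"
proof
  obtain v where v: "v \<in> torus" "v * u = 1" using torus_inverse[OF assms(2)] .
  assume "u * z \<in> \<Omega>"
  then have "v * (u * z) \<in> \<Omega>" by (rule reinhardt_torus[OF assms(1) v(1)])
  then show "z \<in> \<Omega>" by (simp add: v(2) mult.assoc[symmetric])
qed (rule reinhardt_torus[OF assms])

lemma torus_invariant_wmeasure:
  assumes "reinhardt \<Omega>" "multi_radial \<Omega> wt" "(\<lambda>z. wt z * indicator \<Omega> z) \<in> borel_measurable lebesgue"
  shows "torus_invariant (wmeasure \<Omega> wt)"
  unfolding wmeasure_def
proof (rule torus_invariant_density[OF torus_invariant_lebesgue assms(3)])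
  fix u z :: "complex^'a" assume u: "u \<in> torus"
  show "wt (u * z) * indicator \<Omega> (u * z) = wt z * indicator \<Omega> z"
  proof (cases "z \<in> \<Omega>")
    case True
    have "u * z \<in> \<Omega>" using assms(1) u True by (rule reinhardt_torus)
    moreover have "\<forall>j. norm ((u * z)$j) = norm (z$j)"
      using u by (simp add: norm_mult torus_def)
    ultimately have "wt (u * z) = wt z"
      using assms(2) True unfolding multi_radial_def by blast
    then show ?thesis using True \<open>u * z \<in> \<Omega>\<close> by simp
  qed (simp add: reinhardt_torus_iff[OF assms(1) u])
qed

lemma dist_vec_le_card:
  fixes x y :: "'a::metric_space^'n"
  assumes "\<And>j. dist (x$j) (y$j) \<le> e"
  shows "dist x y \<le> real CARD('n) * e"
proof -
  have "dist x y \<le> (\<Sum>j\<in>UNIV. dist (x$j) (y$j))"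
    unfolding dist_vec_def by (rule L2_set_le_sum) simp
  also have "\<dots> \<le> (\<Sum>j\<in>(UNIV::'n set). e)"
    by (intro sum_mono assms)
  finally show ?thesis by simp
qed

lemma open_contains_nonzero_coordinates:
  fixes \<Omega> :: "(complex^'n) set"
  assumes "open \<Omega>" "a \<in> \<Omega>"
  obtains b where "b \<in> \<Omega>" "\<And>j. j \<in> J \<Longrightarrow> b$j = a$j" "\<And>j. j \<notin> J \<Longrightarrow> b$j \<noteq> 0"
proof -
  obtain e where e: "0 < e" "cball a e \<subseteq> \<Omega>"
    using assms open_contains_cball by blast
  define \<delta> where "\<delta> = e / real CARD('n)"
  have "0 < \<delta>" using e(1) by (simp add: \<delta>_def)
  define b where "b = (\<chi> j. if j \<in> J \<or> a$j \<noteq> 0 then a$j else of_real \<delta>)"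
  have "dist a b \<le> real CARD('n) * \<delta>"
    using \<open>0 < \<delta>\<close> by (intro dist_vec_le_card) (simp add: b_def)
  then have "b \<in> \<Omega>" using e by (auto simp: \<delta>_def)
  then show thesis
    using \<open>0 < \<delta>\<close> by (intro that[of b]) (auto simp: b_def)
qed

lemma open_nonempty_contains_nonzero_coordinates:
  fixes \<Omega> :: "(complex^'n) set"
  assumes "open \<Omega>" "\<Omega> \<noteq> {}"
  obtains a where "a \<in> \<Omega>" "\<And>j. a$j \<noteq> 0"
proof -
  obtain b where "b \<in> \<Omega>" using assms(2) by blast
  then obtain a where "a \<in> \<Omega>" "\<And>j. j \<notin> {} \<Longrightarrow> a$j \<noteq> 0"
    using open_contains_nonzero_coordinates[OF assms(1)] by metis
  then show thesis using that by simp
qed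

lemma laurent_series_unique:
  fixes \<Omega> :: "(complex^'n::finite) set"
  assumes "open \<Omega>" "\<Omega> \<noteq> {}" "reinhardt \<Omega>"
    and c: "laurent_series \<Omega> f c" and c': "laurent_series \<Omega> f c'"
  shows "c = c'"
proof
  fix \<beta>
  obtain a where a: "a \<in> \<Omega>" "\<And>j. a$j \<noteq> 0"
    using open_nonempty_contains_nonzero_coordinates[OF assms(1,2)] by blast
  have "((\<lambda>\<alpha>. (c \<alpha> - c' \<alpha>) * monom \<alpha> a * monom \<alpha> u) has_sum 0) UNIV" if "u \<in> torus" for u
  proof -
    have "u * a \<in> \<Omega>" using assms(3) that a(1) by (rule reinhardt_torus)
    then have "((\<lambda>\<alpha>. c \<alpha> * monom \<alpha> (u * a) + - (c' \<alpha> * monom \<alpha> (u * a)))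
        has_sum (f (u * a) + - f (u * a))) UNIV"
      using c c' by (intro has_sum_add has_sum_uminusI) (auto simp: laurent_series_def)
    then show ?thesis by (simp add: monom_mult algebra_simps)
  qed
  then have "(c \<beta> - c' \<beta>) * monom \<beta> a = 0"
    by (rule torus_series_coeff_eq_0)
  then show "c \<beta> = c' \<beta>"
    using monom_nonzero[OF a(2)] by simp
qed

section \<open>Geometric growth of monomials\<close>

text \<open>For negative \<open>\<alpha> j\<close> the monomial is unbounded near \<open>z\<close>, while its value at \<open>z\<close> is \<open>inverse 0 = 0\<close>.\<close>
lemma exponent_nonneg_if_isCont_monom:
  assumes \<Omega>: "open \<Omega>" "z \<in> \<Omega>" and "z$j = 0" and cont: "\<And>w. w \<in> \<Omega> \<Longrightarrow> isCont (monom \<alpha>) w"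
  shows "0 \<le> \<alpha> j"
proof (rule ccontr)
  assume neg: "\<not> 0 \<le> \<alpha> j"
  obtain b where b: "b \<in> \<Omega>" "b$j = 0" "\<And>i. i \<noteq> j \<Longrightarrow> b$i \<noteq> 0"
    using open_contains_nonzero_coordinates[OF \<Omega>, of "{j}"] \<open>z$j = 0\<close> by auto
  define Q where "Q = (\<Prod>i\<in>UNIV - {j}. norm (b$i) powi \<alpha> i)"
  have "0 < Q" unfolding Q_def using b(3) by (intro prod_pos) simp
  define w where "w n = (\<chi> i. if i = j then of_real (inverse (real (Suc n))) else b$i)" for n
  have "Q \<le> norm (monom \<alpha> (w n))" for n
  proof -
    have "norm (monom \<alpha> (w n)) = norm (w n$j) powi \<alpha> j * Q"
      unfolding norm_monom Q_def by (subst prod.remove[of _ j]) (auto simp: w_def intro!: prod.cong)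
    moreover have "1 \<le> norm (w n$j) powi \<alpha> j"
      using neg by (simp add: w_def norm_inverse power_int_def one_le_power del: of_nat_Suc)
    ultimately show ?thesis using \<open>0 < Q\<close> by simp
  qed
  moreover have "(\<lambda>n. norm (monom \<alpha> (w n))) \<longlonglongrightarrow> norm (monom \<alpha> b)"
  proof (intro tendsto_norm isCont_tendsto_compose[OF cont[OF b(1)]] vec_tendstoI)
    fix i
    have "(\<lambda>n. complex_of_real (inverse (real (Suc n)))) \<longlonglongrightarrow> of_real 0"
      by (rule tendsto_of_real[OF LIMSEQ_inverse_real_of_nat])
    then show "(\<lambda>n. w n$i) \<longlonglongrightarrow> b$i"
      using b(2) by (cases "i = j") (simp_all add: w_def)
  qed
  moreover have "monom \<alpha> b = 0"
    using b(2) neg unfolding monom_def by (intro prod_zero) (auto intro!: bexI[of _ j])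
  ultimately have "Q \<le> 0"
    by (intro LIMSEQ_le_const) auto
  then show False using \<open>0 < Q\<close> by simp
qed

lemma cball_contains_norm_shift:
  fixes z :: "'a::{real_normed_vector, perfect_space}"
  assumes "0 \<le> norm z + s"
  obtains t where "t \<in> cball z \<bar>s\<bar>" "norm t = norm z + s"
proof (cases "z = 0")
  case True
  then show thesis using vector_choose_size[of "norm z + s"] assms that by (auto simp: dist_norm)
next
  case False
  define t where "t = (1 + s / norm z) *\<^sub>R z"
  have "0 \<le> 1 + s / norm z" using assms False by (simp add: field_simps)
  then have "norm t = norm z + s" using False by (simp add: t_def field_simps)
  moreover have "z - t = - (s / norm z) *\<^sub>R z" by (simp add: t_def scaleR_add_left)
  then have "dist z t = \<bar>s\<bar>" using False by (simp add: dist_norm)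
  ultimately show thesis using that[of t] by simp
qed

lemma powi_geometric_bound:
  fixes z :: complex
  assumes e: "0 < e" and R: "norm z \<le> R" "0 < R" and k: "e < norm z \<or> 0 \<le> k"
  obtains t where "t \<in> cball z e" "norm z powi k \<le> (R / (R + e)) ^ nat \<bar>k\<bar> * norm t powi k"
proof (cases "0 \<le> k")
  case True
  obtain t where t: "t \<in> cball z e" "norm t = norm z + e"
    using cball_contains_norm_shift[of z e] e by auto
  have "norm z * (R + e) \<le> R * (norm z + e)" using R e by (simp add: algebra_simps)
  then have "norm z \<le> R / (R + e) * norm t" using e R t(2) by (simp add: field_simps)
  then have "norm z ^ nat k \<le> (R / (R + e) * norm t) ^ nat k" by (intro power_mono) auto
  then show thesis using that t(1) True by (simp add: power_int_def power_mult_distrib power_divide)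
next
  case False
  then have "e < norm z" using k by simp
  then obtain t where t: "t \<in> cball z e" "norm t = norm z - e"
    using cball_contains_norm_shift[of z "- e"] e by auto
  have "e * norm z \<le> e * (R + e)"
    using R(1) e by (intro mult_left_mono) auto
  then have "norm t * (R + e) \<le> R * norm z"
    by (simp add: t(2) algebra_simps)
  moreover have "0 < norm t" "0 < norm z" using t(2) e \<open>e < norm z\<close> by auto
  ultimately have "inverse (norm z) \<le> R / (R + e) * inverse (norm t)"
    using e R by (simp add: divide_simps mult.commute)
  then have "inverse (norm z) ^ nat (-k) \<le> (R / (R + e) * inverse (norm t)) ^ nat (-k)"
    by (intro power_mono) auto
  then show thesis using that t(1) False by (simp add: power_int_def power_mult_distrib power_divide)
qed

lemma monom_geometric_bound:
  fixes z :: "complex^'n::finite"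
  assumes e: "0 < e" and R: "\<And>j. norm (z$j) \<le> R" "0 < R" and \<alpha>: "\<And>j. e < norm (z$j) \<or> 0 \<le> \<alpha> j"
  obtains t where "dist z t \<le> real CARD('n) * e"
    "norm (monom \<alpha> z) \<le> (\<Prod>j\<in>UNIV. (R / (R + e)) ^ nat \<bar>\<alpha> j\<bar>) * norm (monom \<alpha> t)"
proof -
  have "\<exists>t. t \<in> cball (z$j) e \<and> norm (z$j) powi \<alpha> j \<le> (R / (R + e)) ^ nat \<bar>\<alpha> j\<bar> * norm t powi \<alpha> j" for j
    using powi_geometric_bound[OF e R(1) R(2) \<alpha>] by metis
  then obtain t where t: "\<And>j. t j \<in> cball (z$j) e"
      "\<And>j. norm (z$j) powi \<alpha> j \<le> (R / (R + e)) ^ nat \<bar>\<alpha> j\<bar> * norm (t j) powi \<alpha> j"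
    by metis
  show thesis
  proof (rule that[of "\<chi> j. t j"])
    show "dist z (\<chi> j. t j) \<le> real CARD('n) * e"
      using t(1) by (intro dist_vec_le_card) simp
    have "norm (monom \<alpha> z) \<le> (\<Prod>j\<in>UNIV. (R / (R + e)) ^ nat \<bar>\<alpha> j\<bar> * norm (t j) powi \<alpha> j)"
      unfolding norm_monom by (intro prod_mono conjI t(2)) simp
    then show "norm (monom \<alpha> z) \<le> (\<Prod>j\<in>UNIV. (R / (R + e)) ^ nat \<bar>\<alpha> j\<bar>) * norm (monom \<alpha> (\<chi> j. t j))"
      by (simp add: norm_monom prod.distrib)
  qed
qed

lemma summable_on_geometric_int:
  fixes \<rho> :: real
  assumes "0 \<le> \<rho>" "\<rho> < 1"
  shows "(\<lambda>k::int. \<rho> ^ nat \<bar>k\<bar>) summable_on UNIV"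
proof -
  have nat: "(\<lambda>n. \<rho> ^ n) summable_on (UNIV :: nat set)"
    using assms by (intro norm_summable_imp_summable_on) (simp add: summable_geometric)
  have "(\<lambda>k::int. \<rho> ^ nat \<bar>k\<bar>) summable_on range int"
    using nat by (subst summable_on_reindex) (auto simp: o_def)
  moreover have "(\<lambda>k::int. \<rho> ^ nat \<bar>k\<bar>) summable_on range (\<lambda>n. - int (Suc n))"
    using summable_on_cmult_right[OF nat, of \<rho>]
    by (subst summable_on_reindex) (auto simp: o_def inj_on_def nat_add_distrib)
  ultimately have "(\<lambda>k::int. \<rho> ^ nat \<bar>k\<bar>) summable_on (range int \<union> range (\<lambda>n. - int (Suc n)))"
    by (rule summable_on_Un_disjoint) auto
  moreover have "k \<in> range int \<union> range (\<lambda>n. - int (Suc n))" for k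
    by (cases k rule: int_cases) auto
  then have "range int \<union> range (\<lambda>n. - int (Suc n)) = UNIV" by blast
  ultimately show ?thesis by simp
qed

lemma summable_on_prod_UNIV:
  fixes f :: "'n::finite \<Rightarrow> 'a::countable \<Rightarrow> real"
  assumes "\<And>j. f j summable_on UNIV"
  shows "(\<lambda>\<alpha>. \<Prod>j\<in>UNIV. f j (\<alpha> j)) summable_on UNIV"
proof -
  have "Infinite_Set_Sum.abs_summable_on (f j) UNIV" for j
    using assms[of j] abs_summable_equivalent[of "f j" UNIV]
      summable_on_iff_abs_summable_on_real[of "f j" UNIV] by (simp only:)
  then have "Infinite_Set_Sum.abs_summable_on (\<lambda>\<alpha>. \<Prod>j\<in>UNIV. f j (\<alpha> j)) (PiE UNIV (\<lambda>_. UNIV))"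
    by (intro abs_summable_on_prod_PiE) auto
  then have "(\<lambda>\<alpha>. \<Prod>j\<in>UNIV. f j (\<alpha> j)) summable_on PiE UNIV (\<lambda>_. UNIV)"
    by (rule abs_summable_summable[OF abs_summable_equivalent[THEN iffD2]])
  moreover have "PiE UNIV (\<lambda>_::'n. UNIV :: 'a set) = UNIV" by auto
  ultimately show ?thesis by simp
qed

section \<open>Weighted spaces of holomorphic functions\<close>

lemma mem_Lp_space_iff: "f \<in> Lp_space \<Omega> wt p \<longleftrightarrow> p_integrable (wmeasure \<Omega> wt) p f"
  by (auto simp: Lp_space_def p_integrable_def integrable_iff_bounded)

lemma Lpnorm_eq_p_norm:
  assumes "f \<in> borel_measurable (wmeasure \<Omega> wt)"
  shows "Lpnorm \<Omega> wt p f = p_norm (wmeasure \<Omega> wt) p f"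
  using assms by (simp add: Lpnorm_def p_norm_def integral_eq_nn_integral)

lemma borel_measurable_wmeasure_monom: "monom \<alpha> \<in> borel_measurable (wmeasure \<Omega> wt)"
  unfolding wmeasure_def measurable_density_eq1
  by (rule measurable_completion) (simp add: borel_measurable_monom)

lemma AE_wmeasure_in:
  assumes "(\<lambda>z. wt z * indicator \<Omega> z) \<in> borel_measurable lebesgue"
  shows "AE z in wmeasure \<Omega> wt. z \<in> \<Omega>"
  unfolding wmeasure_def using assms by (subst AE_density) (auto simp: indicator_def)

lemma holo_n_add:
  assumes "holo_n \<Omega> f" "holo_n \<Omega> g" shows "holo_n \<Omega> (\<lambda>z. f z + g z)"
  unfolding holo_n_def
proof
  fix z assume "z \<in> \<Omega>"
  then obtain L L' where "(f has_derivative L) (at z)" "\<forall>c v. L (c *s v) = c * L v"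
      "(g has_derivative L') (at z)" "\<forall>c v. L' (c *s v) = c * L' v"
    using assms unfolding holo_n_def by meson
  then show "\<exists>L. ((\<lambda>z. f z + g z) has_derivative L) (at z) \<and> (\<forall>c v. L (c *s v) = c * L v)"
    by (intro exI[of _ "\<lambda>v. L v + L' v"]) (auto intro: has_derivative_add simp: distrib_left)
qed

lemma holo_n_cmult:
  assumes "holo_n \<Omega> f" shows "holo_n \<Omega> (\<lambda>z. c * f z)"
  unfolding holo_n_def
proof
  fix z assume "z \<in> \<Omega>"
  then obtain L where "(f has_derivative L) (at z)" "\<forall>c v. L (c *s v) = c * L v"
    using assms unfolding holo_n_def by blast
  then show "\<exists>L. ((\<lambda>z. c * f z) has_derivative L) (at z) \<and> (\<forall>c v. L (c *s v) = c * L v)"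
    by (intro exI[of _ "\<lambda>v. c * L v"]) (auto intro: has_derivative_mult_right)
qed

lemma holo_n_zero: "holo_n \<Omega> (\<lambda>z. 0)"
  unfolding holo_n_def by (auto intro!: exI[of _ "\<lambda>_. 0"])

lemma holo_n_diff: "holo_n \<Omega> f \<Longrightarrow> holo_n \<Omega> g \<Longrightarrow> holo_n \<Omega> (\<lambda>z. f z - g z)"
  using holo_n_add[of \<Omega> f "\<lambda>z. (-1) * g z"] holo_n_cmult[of \<Omega> g "-1"] by simp

lemma holo_n_sum: "(\<And>i. i \<in> I \<Longrightarrow> holo_n \<Omega> (f i)) \<Longrightarrow> holo_n \<Omega> (\<lambda>z. \<Sum>i\<in>I. f i z)"
  by (induction I rule: infinite_finite_induct) (auto intro: holo_n_add holo_n_zero)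

lemma isCont_holo_n: "holo_n \<Omega> f \<Longrightarrow> z \<in> \<Omega> \<Longrightarrow> isCont f z"
  unfolding holo_n_def using has_derivative_continuous by blast

lemma exponent_nonneg_near_hyperplane:
  fixes z :: "complex^'n"
  assumes "open \<Omega>" "holo_n \<Omega> (monom \<alpha>)" "cball z e \<subseteq> \<Omega>" "norm (z$j) \<le> e"
  shows "0 \<le> \<alpha> j"
proof -
  define y where "y = (\<chi> i. if i = j then 0 else z$i)"
  have "norm (z - y) = norm (z$j)"
    unfolding norm_vec_def y_def by (simp add: L2_set_def if_distrib if_distribR sum.delta cong: if_cong)
  then have "y \<in> \<Omega>" using assms(3,4) by (auto simp: dist_norm)
  then show ?thesis
    using assms(1,2) by (intro exponent_nonneg_if_isCont_monom[of \<Omega> y]) (auto simp: y_def isCont_holo_n)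
qed

lemma holo_n_monom_geometric_bound:
  fixes z :: "complex^'n::finite"
  assumes \<Omega>: "open \<Omega>" "holo_n \<Omega> (monom \<alpha>)" and e: "0 < e" "cball z e \<subseteq> \<Omega>" and R: "norm z \<le> R" "0 < R"
  obtains t where "t \<in> cball z e"
    "norm (monom \<alpha> z) \<le> (\<Prod>j\<in>UNIV. (R / (R + e / real CARD('n))) ^ nat \<bar>\<alpha> j\<bar>) * norm (monom \<alpha> t)"
proof -
  define \<eta> where "\<eta> = e / real CARD('n)"
  have \<eta>: "0 < \<eta>" "\<eta> \<le> e" "real CARD('n) * \<eta> = e"
    using e(1) by (simp_all add: \<eta>_def divide_le_eq)
  have "cball z \<eta> \<subseteq> \<Omega>" using e(2) subset_cball[OF \<eta>(2), of z] by blast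
  then have "\<eta> < norm (z$j) \<or> 0 \<le> \<alpha> j" for j
    using exponent_nonneg_near_hyperplane[OF \<Omega>] by (meson linorder_not_less)
  moreover have "norm (z$j) \<le> R" for j
    using Finite_Cartesian_Product.norm_nth_le[of z j] R(1) by simp
  ultimately obtain t where "dist z t \<le> real CARD('n) * \<eta>"
      "norm (monom \<alpha> z) \<le> (\<Prod>j\<in>UNIV. (R / (R + \<eta>)) ^ nat \<bar>\<alpha> j\<bar>) * norm (monom \<alpha> t)"
    using monom_geometric_bound[OF \<eta>(1) _ R(2)] by metis
  then show thesis using \<eta>(3) by (intro that[of t]) (simp_all add: \<eta>_def)
qed

lemma summable_on_SUP_norm:
  assumes "H summable_on I" "K \<noteq> {}" and bound: "\<And>i z. i \<in> I \<Longrightarrow> z \<in> K \<Longrightarrow> norm (F i z) \<le> H i"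
  shows "(\<lambda>i. SUP z\<in>K. norm (F i z)) summable_on I"
proof (rule summable_on_comparison_test[OF assms(1)])
  obtain a where a: "a \<in> K" using \<open>K \<noteq> {}\<close> by blast
  fix i assume i: "i \<in> I"
  show "(SUP z\<in>K. norm (F i z)) \<le> H i"
    by (rule cSUP_least[OF \<open>K \<noteq> {}\<close> bound[OF i]])
  have "norm (F i a) \<le> (SUP z\<in>K. norm (F i z))"
    by (rule cSUP_upper[OF a bdd_aboveI2[OF bound[OF i]]])
  then show "0 \<le> (SUP z\<in>K. norm (F i z))"
    by (rule order_trans[OF norm_ge_zero])
qed

lemma supnorm_le_iff: "supnorm \<alpha> \<le> int N \<longleftrightarrow> (\<forall>j. \<bar>\<alpha> j\<bar> \<le> int N)"
  unfolding supnorm_def by (subst Max_le_iff) auto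

lemma finite_supnorm_le: "finite {\<alpha>::'n::finite \<Rightarrow> int. supnorm \<alpha> \<le> int N}"
proof (rule finite_subset)
  show "{\<alpha>::'n \<Rightarrow> int. supnorm \<alpha> \<le> int N} \<subseteq> (\<Pi>\<^sub>E j\<in>UNIV. {- int N..int N})"
    by (auto simp: supnorm_le_iff abs_le_iff) (metis minus_le_iff)
qed (auto intro: finite_PiE)

lemma finite_trunc_set: "finite (trunc_set \<Omega> wt p N)"
  unfolding trunc_set_def by (rule finite_subset[OF _ finite_supnorm_le]) auto

lemma trunc_set_mono: "m \<le> n \<Longrightarrow> trunc_set \<Omega> wt p m \<subseteq> trunc_set \<Omega> wt p n"
  unfolding trunc_set_def by auto

lemma trunc_set_subset: "trunc_set \<Omega> wt p N \<subseteq> Sp_set \<Omega> wt p"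
  unfolding trunc_set_def by auto

lemma eventually_mem_trunc_set:
  assumes "\<alpha> \<in> Sp_set \<Omega> wt p"
  shows "\<forall>\<^sub>F N in sequentially. \<alpha> \<in> trunc_set \<Omega> wt p N"
  using assms unfolding trunc_set_def
  by (intro eventually_sequentiallyI[of "nat (supnorm \<alpha>)"]) (simp add: nat_le_iff)

lemma eventually_subset_trunc_set:
  assumes "finite X" "X \<subseteq> Sp_set \<Omega> wt p"
  shows "\<forall>\<^sub>F N in sequentially. X \<subseteq> trunc_set \<Omega> wt p N"
  unfolding subset_eq using assms
  by (intro eventually_ball_finite ballI eventually_mem_trunc_set) auto

lemma filterlim_trunc_set:
  "filterlim (trunc_set \<Omega> wt p) (finite_subsets_at_top (Sp_set \<Omega> wt p)) sequentially"
  unfolding filterlim_finite_subsets_at_top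
  using eventually_subset_trunc_set by (auto simp: finite_trunc_set trunc_set_subset)

lemma has_sum_imp_trunc_sums_tendsto:
  assumes "(f has_sum s) (Sp_set \<Omega> wt p)"
  shows "(\<lambda>N. \<Sum>\<alpha>\<in>trunc_set \<Omega> wt p N. f \<alpha>) \<longlonglongrightarrow> s"
  using filterlim_compose[OF assms[unfolded has_sum_def] filterlim_trunc_set] .

lemma trunc_sums_bounded_imp_convergent:
  fixes f :: "('n::finite \<Rightarrow> int) \<Rightarrow> 'b::banach"
  assumes bound: "\<And>N. (\<Sum>\<alpha>\<in>trunc_set \<Omega> wt p N. norm (f \<alpha>)) \<le> B"
  shows "convergent (\<lambda>N. \<Sum>\<alpha>\<in>trunc_set \<Omega> wt p N. f \<alpha>)"
proof -
  have "(\<Sum>\<alpha>\<in>F. norm (f \<alpha>)) \<le> B" if F: "finite F" "F \<subseteq> Sp_set \<Omega> wt p" for F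
  proof -
    obtain N where "F \<subseteq> trunc_set \<Omega> wt p N"
      using eventually_subset_trunc_set[OF F] by (auto simp: eventually_sequentially)
    then have "(\<Sum>\<alpha>\<in>F. norm (f \<alpha>)) \<le> (\<Sum>\<alpha>\<in>trunc_set \<Omega> wt p N. norm (f \<alpha>))"
      by (intro sum_mono2 finite_trunc_set) auto
    then show ?thesis using bound by (rule order_trans)
  qed
  then have "(\<lambda>\<alpha>. norm (f \<alpha>)) summable_on Sp_set \<Omega> wt p"
    by (intro nonneg_bdd_above_summable_on) (auto intro!: bdd_aboveI2[where M = B])
  then have "f summable_on Sp_set \<Omega> wt p" by (rule abs_summable_summable)
  then show ?thesis
    using has_sum_imp_trunc_sums_tendsto unfolding summable_on_def convergent_def by blast
qed

definition norm_preserving_extension :: "(complex^'n::finite) set \<Rightarrow> (complex^'n \<Rightarrow> ennreal) \<Rightarrow> real \<Rightarrow>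
    ('n \<Rightarrow> int) \<Rightarrow> ((complex^'n \<Rightarrow> complex) \<Rightarrow> complex) \<Rightarrow> bool" where
  "norm_preserving_extension \<Omega> wt p \<alpha> \<Phi> \<longleftrightarrow>
      (\<forall>f. f \<notin> Lp_space \<Omega> wt p \<longrightarrow> \<Phi> f = 0) \<and>
      (\<forall>f\<in>Ap_space \<Omega> wt p. \<Phi> f = laurent_coeff \<Omega> \<alpha> f) \<and>
      (\<forall>f\<in>Lp_space \<Omega> wt p. \<forall>g\<in>Lp_space \<Omega> wt p. \<Phi> (\<lambda>z. f z + g z) = \<Phi> f + \<Phi> g) \<and>
      (\<forall>f\<in>Lp_space \<Omega> wt p. \<forall>c. \<Phi> (\<lambda>z. c * f z) = c * \<Phi> f) \<and>
      (\<forall>f\<in>Lp_space \<Omega> wt p. norm (\<Phi> f) \<le> coeff_opnorm \<Omega> wt p \<alpha> * Lpnorm \<Omega> wt p f)"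

lemma ext_coeff_eq_The: "ext_coeff \<Omega> wt p \<alpha> = (THE \<Phi>. norm_preserving_extension \<Omega> wt p \<alpha> \<Phi>)"
  by (simp add: ext_coeff_def norm_preserving_extension_def)

section \<open>Laurent coefficients as norming functionals\<close>

locale weighted_reinhardt =
  fixes \<Omega> :: "(complex^'n::finite) set" and wt :: "complex^'n \<Rightarrow> ennreal" and p :: real
  assumes open_\<Omega>: "open \<Omega>" and nonempty_\<Omega>: "\<Omega> \<noteq> {}" and reinhardt_\<Omega>: "reinhardt \<Omega>"
    and p_gt_1: "1 < p"
    and wt_measurable: "(\<lambda>z. wt z * indicator \<Omega> z) \<in> borel_measurable lebesgue"
    and admissible_wt: "admissible \<Omega> wt p" and multi_radial_wt: "multi_radial \<Omega> wt"
begin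

abbreviation "M \<equiv> wmeasure \<Omega> wt"
abbreviation "Ap \<equiv> Ap_space \<Omega> wt p"
abbreviation "Sp \<equiv> Sp_set \<Omega> wt p"
abbreviation "trunc \<equiv> trunc_set \<Omega> wt p"
abbreviation "pnorm \<equiv> p_norm M p"
abbreviation coeff :: "('n \<Rightarrow> int) \<Rightarrow> (complex^'n \<Rightarrow> complex) \<Rightarrow> complex" where
  "coeff \<alpha> \<equiv> norming_functional M p (monom \<alpha>)"

lemma mem_Ap_iff: "f \<in> Ap \<longleftrightarrow> p_integrable M p f \<and> holo_n \<Omega> f"
  by (simp add: Ap_space_def mem_Lp_space_iff)

lemma mem_Sp_iff: "\<alpha> \<in> Sp \<longleftrightarrow> p_integrable M p (monom \<alpha>) \<and> holo_n \<Omega> (monom \<alpha>)"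
  by (simp add: Sp_set_def mem_Ap_iff)

lemma monom_in_Ap: "\<alpha> \<in> Sp \<Longrightarrow> monom \<alpha> \<in> Ap"
  by (simp add: Sp_set_def)

lemma p_integrable_Ap: "f \<in> Ap \<Longrightarrow> p_integrable M p f"
  by (simp add: mem_Ap_iff)

lemma p_integrable_monom: "\<alpha> \<in> Sp \<Longrightarrow> p_integrable M p (monom \<alpha>)"
  by (simp add: mem_Sp_iff)

lemma Lpnorm_eq_pnorm: "p_integrable M p f \<Longrightarrow> Lpnorm \<Omega> wt p f = pnorm f"
  by (intro Lpnorm_eq_p_norm borel_measurable_p_integrable)

lemma Ap_diff: "f \<in> Ap \<Longrightarrow> g \<in> Ap \<Longrightarrow> (\<lambda>z. f z - g z) \<in> Ap"
  using p_gt_1 by (simp add: mem_Ap_iff p_integrable_diff holo_n_diff)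

lemma laurent_polynomial_in_Ap: "I \<subseteq> Sp \<Longrightarrow> (\<lambda>z. \<Sum>\<alpha>\<in>I. c \<alpha> * monom \<alpha> z) \<in> Ap"
  using p_gt_1 unfolding mem_Ap_iff
  by (auto intro!: p_integrable_sum p_integrable_cmult holo_n_sum holo_n_cmult simp: mem_Sp_iff)

lemma Ap_pointwise_bound:
  assumes "compact K" "K \<subseteq> \<Omega>"
  obtains C where "0 \<le> C" "\<And>f z. f \<in> Ap \<Longrightarrow> z \<in> K \<Longrightarrow> norm (f z) \<le> C * pnorm f"
proof -
  obtain C where C: "\<And>f z. f \<in> Ap \<Longrightarrow> z \<in> K \<Longrightarrow> norm (f z) \<le> C * pnorm f"
    using admissible_wt assms unfolding admissible_def by (metis Lpnorm_eq_pnorm p_integrable_Ap)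
  have "C * pnorm f \<le> \<bar>C\<bar> * pnorm f" for f :: "complex^'n \<Rightarrow> complex"
    by (intro mult_right_mono p_norm_nonneg) auto
  then show thesis using C by (intro that[of "\<bar>C\<bar>"]) (auto intro: order_trans)
qed

lemma Ap_evaluation_bound:
  assumes "z \<in> \<Omega>"
  obtains C where "\<And>f. f \<in> Ap \<Longrightarrow> norm (f z) \<le> C * pnorm f"
proof -
  have "compact {z}" "{z} \<subseteq> \<Omega>" using assms by auto
  then show thesis using that by (rule Ap_pointwise_bound) blast
qed

lemma pnorm_monom_pos:
  assumes "\<alpha> \<in> Sp" shows "0 < pnorm (monom \<alpha>)"
proof -
  obtain a where a: "a \<in> \<Omega>" "\<And>j. a$j \<noteq> 0"
    using open_nonempty_contains_nonzero_coordinates[OF open_\<Omega> nonempty_\<Omega>] by blast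
  then obtain C where "norm (monom \<alpha> a) \<le> C * pnorm (monom \<alpha>)"
    using Ap_evaluation_bound[OF a(1)] monom_in_Ap[OF assms] by metis
  then have "pnorm (monom \<alpha>) \<noteq> 0"
    using monom_nonzero[OF a(2)] by auto
  then show ?thesis using p_norm_nonneg[of M p "monom \<alpha>"] by simp
qed

lemma norm_coeff_le: "\<alpha> \<in> Sp \<Longrightarrow> p_integrable M p f \<Longrightarrow> norm (coeff \<alpha> f) \<le> pnorm f / pnorm (monom \<alpha>)"
  by (intro norm_norming_functional_le p_gt_1 p_integrable_monom)

lemma coeff_cong:
  assumes "p_integrable M p f" "p_integrable M p g" "\<And>z. z \<in> \<Omega> \<Longrightarrow> f z = g z"
  shows "coeff \<alpha> f = coeff \<alpha> g"
proof -
  note [measurable] = borel_measurable_dual_power[OF p_gt_1] borel_measurable_wmeasure_monom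
    borel_measurable_p_integrable[OF assms(1)] borel_measurable_p_integrable[OF assms(2)]
  have "(\<integral>z. f z * dual_power p (monom \<alpha> z) \<partial>M) = (\<integral>z. g z * dual_power p (monom \<alpha> z) \<partial>M)"
    using AE_wmeasure_in[OF wt_measurable] assms(3) by (intro integral_cong_AE) (auto elim: eventually_mono)
  then show ?thesis by (simp add: norming_functional_def)
qed

lemma coeff_monom:
  assumes "\<alpha> \<in> Sp"
  shows "coeff \<alpha> (monom \<beta>) = (if \<alpha> = \<beta> then 1 else 0)"
proof (cases "\<alpha> = \<beta>")
  case True
  then show ?thesis using p_gt_1 pnorm_monom_pos[OF assms] by (simp add: norming_functional_self)
next
  case False
  have "torus_invariant M"
    by (rule torus_invariant_wmeasure[OF reinhardt_\<Omega> multi_radial_wt wt_measurable])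
  then show ?thesis
    using False by (simp add: norming_functional_def integral_monom_dual_power_eq_0)
qed

lemma coeff_laurent_polynomial:
  assumes "finite I" "I \<subseteq> Sp" "\<alpha> \<in> Sp"
  shows "coeff \<alpha> (\<lambda>z. \<Sum>\<beta>\<in>I. c \<beta> * monom \<beta> z) = (if \<alpha> \<in> I then c \<alpha> else 0)"
proof -
  have "coeff \<alpha> (\<lambda>z. \<Sum>\<beta>\<in>I. c \<beta> * monom \<beta> z) = (\<Sum>\<beta>\<in>I. coeff \<alpha> (\<lambda>z. c \<beta> * monom \<beta> z))"
    using assms p_gt_1 by (intro norming_functional_sum p_integrable_cmult p_integrable_monom) auto
  also have "\<dots> = (\<Sum>\<beta>\<in>I. if \<alpha> = \<beta> then c \<beta> else 0)"
    by (rule sum.cong) (auto simp: norming_functional_cmult coeff_monom assms(3))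
  finally show ?thesis using assms(1) by simp
qed

text \<open>A point of \<open>K\<close> can be moved within a slightly larger compact set \<open>L\<close> so that \<open>\<bar>monom \<alpha>\<bar>\<close> grows
  geometrically in \<open>\<alpha>\<close>, and admissibility bounds \<open>monom \<alpha>\<close> on \<open>L\<close>.\<close>
lemma monom_compact_bound:
  assumes K: "compact K" "K \<subseteq> \<Omega>"
  obtains h where "h summable_on UNIV" "\<And>\<alpha>. 0 \<le> h \<alpha>"
    "\<And>\<alpha> z. \<alpha> \<in> Sp \<Longrightarrow> z \<in> K \<Longrightarrow> norm (monom \<alpha> z) \<le> h \<alpha> * pnorm (monom \<alpha>)"
proof -
  obtain e where e: "0 < e" "(\<Union>z\<in>K. cball z e) \<subseteq> \<Omega>"
    using compact_subset_open_imp_cball_epsilon_subset[OF K(1) open_\<Omega> K(2)] .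
  define L where "L = (\<Union>z\<in>K. cball z e)"
  have "compact L" unfolding L_def by (rule compact_minkowski_sum_cball[OF K(1)])
  then obtain C where C: "0 \<le> C" "\<And>f z. f \<in> Ap \<Longrightarrow> z \<in> L \<Longrightarrow> norm (f z) \<le> C * pnorm f"
    using Ap_pointwise_bound e(2) unfolding L_def by blast
  obtain R where R: "0 < R" "\<And>z. z \<in> K \<Longrightarrow> norm z \<le> R"
    using compact_imp_bounded[OF K(1)] bounded_pos by blast
  define \<eta> where "\<eta> = e / real CARD('n)"
  define \<rho> where "\<rho> = R / (R + \<eta>)"
  have "0 < \<eta>" using e(1) by (simp add: \<eta>_def)
  then have \<rho>: "0 \<le> \<rho>" "\<rho> < 1" using R(1) by (simp_all add: \<rho>_def)
  define g where "g \<alpha> = (\<Prod>j\<in>UNIV. \<rho> ^ nat \<bar>\<alpha> j\<bar>)" for \<alpha> :: "'n \<Rightarrow> int"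
  have g_nonneg: "0 \<le> g \<alpha>" for \<alpha>
    unfolding g_def using \<rho>(1) by (intro prod_nonneg) auto
  have "norm (monom \<alpha> z) \<le> C * g \<alpha> * pnorm (monom \<alpha>)" if \<alpha>: "\<alpha> \<in> Sp" and z: "z \<in> K" for \<alpha> z
  proof -
    have "cball z e \<subseteq> L" using z by (auto simp: L_def)
    then obtain t where t: "t \<in> L" "norm (monom \<alpha> z) \<le> g \<alpha> * norm (monom \<alpha> t)"
      using holo_n_monom_geometric_bound[of \<Omega> \<alpha> e z R] open_\<Omega> \<alpha> e R(1) R(2)[OF z]
      unfolding L_def g_def \<rho>_def \<eta>_def mem_Sp_iff by (metis subset_iff)
    note t(2)
    also have "g \<alpha> * norm (monom \<alpha> t) \<le> g \<alpha> * (C * pnorm (monom \<alpha>))"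
      using g_nonneg by (intro mult_left_mono C(2) monom_in_Ap \<alpha> t(1))
    finally show ?thesis by (simp add: mult_ac)
  qed
  moreover have "(\<lambda>\<alpha>. C * g \<alpha>) summable_on UNIV"
    unfolding g_def using \<rho>
    by (intro summable_on_cmult_right summable_on_prod_UNIV summable_on_geometric_int)
  ultimately show thesis using C(1) g_nonneg by (intro that[of "\<lambda>\<alpha>. C * g \<alpha>"]) auto
qed

definition laurent_coeffs :: "(complex^'n \<Rightarrow> complex) \<Rightarrow> ('n \<Rightarrow> int) \<Rightarrow> complex" where
  "laurent_coeffs g \<alpha> = (if \<alpha> \<in> Sp then coeff \<alpha> g else 0)"

lemma laurent_terms_majorant:
  assumes g: "g \<in> Ap" and K: "compact K" "K \<subseteq> \<Omega>"
  obtains H where "H summable_on UNIV" "\<And>\<alpha> z. z \<in> K \<Longrightarrow> norm (laurent_coeffs g \<alpha> * monom \<alpha> z) \<le> H \<alpha>"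
proof -
  obtain h where h: "h summable_on UNIV" "\<And>\<alpha>. 0 \<le> h \<alpha>"
    "\<And>\<alpha> z. \<alpha> \<in> Sp \<Longrightarrow> z \<in> K \<Longrightarrow> norm (monom \<alpha> z) \<le> h \<alpha> * pnorm (monom \<alpha>)"
    using monom_compact_bound[OF K] by blast
  show thesis
  proof (rule that[OF summable_on_cmult_right[OF h(1), of "pnorm g"]])
    fix \<alpha> z assume z: "z \<in> K"
    show "norm (laurent_coeffs g \<alpha> * monom \<alpha> z) \<le> pnorm g * h \<alpha>"
    proof (cases "\<alpha> \<in> Sp")
      case True
      then have "norm (coeff \<alpha> g) * norm (monom \<alpha> z) \<le> pnorm g / pnorm (monom \<alpha>) * (h \<alpha> * pnorm (monom \<alpha>))"
        using z g
        by (intro mult_mono norm_coeff_le p_integrable_Ap h(3) divide_nonneg_nonneg p_norm_nonneg) auto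
      then show ?thesis using True pnorm_monom_pos[OF True] by (simp add: laurent_coeffs_def norm_mult)
    qed (simp add: laurent_coeffs_def h(2) p_norm_nonneg)
  qed
qed

end

section \<open>The monomial basis projection\<close>

locale monomial_basis_projection = weighted_reinhardt \<Omega> wt p
  for \<Omega> :: "(complex^'n::finite) set" and wt and p +
  fixes P :: "(complex^'n \<Rightarrow> complex) \<Rightarrow> (complex^'n \<Rightarrow> complex)"
  assumes MBP: "is_MBP \<Omega> wt p P"
begin

abbreviation partial_sum :: "(complex^'n \<Rightarrow> complex) \<Rightarrow> nat \<Rightarrow> complex^'n \<Rightarrow> complex" where
  "partial_sum f N z \<equiv> \<Sum>\<alpha>\<in>trunc N. ext_coeff \<Omega> wt p \<alpha> f * monom \<alpha> z"

lemma P_in_Ap: "p_integrable M p f \<Longrightarrow> P f \<in> Ap"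
  using MBP by (simp add: is_MBP_def mem_Lp_space_iff)

lemma P_reproduces: "g \<in> Ap \<Longrightarrow> z \<in> \<Omega> \<Longrightarrow> P g z = g z"
  using MBP by (simp add: is_MBP_def)

lemma remainder_in_Ap: "p_integrable M p f \<Longrightarrow> (\<lambda>z. P f z - partial_sum f N z) \<in> Ap"
  by (intro Ap_diff P_in_Ap laurent_polynomial_in_Ap trunc_set_subset)

lemma pnorm_remainder_tendsto_0:
  assumes "p_integrable M p f"
  shows "(\<lambda>N. pnorm (\<lambda>z. P f z - partial_sum f N z)) \<longlonglongrightarrow> 0"
proof -
  have "(\<lambda>N. Lpnorm \<Omega> wt p (\<lambda>z. P f z - partial_sum f N z)) \<longlonglongrightarrow> 0"
    using MBP assms by (simp add: is_MBP_def mem_Lp_space_iff)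
  then show ?thesis
    by (simp add: Lpnorm_eq_pnorm[OF p_integrable_Ap[OF remainder_in_Ap[OF assms]]])
qed

lemma partial_sum_tendsto_P:
  assumes f: "p_integrable M p f" and z: "z \<in> \<Omega>"
  shows "(\<lambda>N. partial_sum f N z) \<longlonglongrightarrow> P f z"
proof -
  obtain C where C: "\<And>g. g \<in> Ap \<Longrightarrow> norm (g z) \<le> C * pnorm g"
    using Ap_evaluation_bound[OF z] by blast
  have "(\<lambda>N. P f z - partial_sum f N z) \<longlonglongrightarrow> 0"
  proof (rule Lim_null_comparison)
    show "\<forall>\<^sub>F N in sequentially. norm (P f z - partial_sum f N z)
        \<le> C * pnorm (\<lambda>z. P f z - partial_sum f N z)"
      using C[OF remainder_in_Ap[OF f]] by simp
    show "(\<lambda>N. C * pnorm (\<lambda>z. P f z - partial_sum f N z)) \<longlonglongrightarrow> 0"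
      by (rule tendsto_mult_right_zero[OF pnorm_remainder_tendsto_0[OF f]])
  qed
  then have "(\<lambda>N. P f z - (P f z - partial_sum f N z)) \<longlonglongrightarrow> P f z - 0"
    by (intro tendsto_diff tendsto_const)
  then show ?thesis by simp
qed

lemma ext_coeff_eq_coeff_P:
  assumes f: "p_integrable M p f" and \<alpha>: "\<alpha> \<in> Sp"
  shows "ext_coeff \<Omega> wt p \<alpha> f = coeff \<alpha> (P f)"
proof -
  have "(\<lambda>N. coeff \<alpha> (\<lambda>z. P f z - partial_sum f N z)) \<longlonglongrightarrow> 0"
  proof (rule Lim_null_comparison)
    show "\<forall>\<^sub>F N in sequentially. norm (coeff \<alpha> (\<lambda>z. P f z - partial_sum f N z))
        \<le> pnorm (\<lambda>z. P f z - partial_sum f N z) / pnorm (monom \<alpha>)"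
      using norm_coeff_le[OF \<alpha> p_integrable_Ap[OF remainder_in_Ap[OF f]]] by simp
    show "(\<lambda>N. pnorm (\<lambda>z. P f z - partial_sum f N z) / pnorm (monom \<alpha>)) \<longlonglongrightarrow> 0"
      by (rule tendsto_divide_zero[OF pnorm_remainder_tendsto_0[OF f]])
  qed
  moreover have "\<forall>\<^sub>F N in sequentially.
      coeff \<alpha> (\<lambda>z. P f z - partial_sum f N z) = coeff \<alpha> (P f) - ext_coeff \<Omega> wt p \<alpha> f"
    using eventually_mem_trunc_set[OF \<alpha>]
  proof eventually_elim
    case (elim N)
    have "coeff \<alpha> (\<lambda>z. P f z - partial_sum f N z) = coeff \<alpha> (P f) - coeff \<alpha> (partial_sum f N)"
      by (intro norming_functional_diff p_gt_1 p_integrable_monom \<alpha> p_integrable_Ap P_in_Ap f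
          laurent_polynomial_in_Ap trunc_set_subset)
    also have "coeff \<alpha> (partial_sum f N) = ext_coeff \<Omega> wt p \<alpha> f"
      using elim by (simp add: coeff_laurent_polynomial finite_trunc_set trunc_set_subset \<alpha>)
    finally show ?case .
  qed
  ultimately have "(\<lambda>N. coeff \<alpha> (P f) - ext_coeff \<Omega> wt p \<alpha> f) \<longlonglongrightarrow> 0"
    by (rule Lim_transform_eventually)
  then show ?thesis by (simp add: LIMSEQ_const_iff)
qed

lemma ext_coeff_Ap:
  assumes g: "g \<in> Ap" and \<alpha>: "\<alpha> \<in> Sp"
  shows "ext_coeff \<Omega> wt p \<alpha> g = coeff \<alpha> g"
  unfolding ext_coeff_eq_coeff_P[OF p_integrable_Ap[OF g] \<alpha>]
  by (intro coeff_cong p_integrable_Ap P_in_Ap g P_reproduces)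

lemma has_sum_laurent_terms:
  assumes g: "g \<in> Ap" and z: "z \<in> \<Omega>"
  shows "((\<lambda>\<alpha>. laurent_coeffs g \<alpha> * monom \<alpha> z) has_sum g z) UNIV"
proof -
  let ?t = "\<lambda>\<alpha>. laurent_coeffs g \<alpha> * monom \<alpha> z"
  obtain H where "H summable_on UNIV" "\<And>\<alpha>. norm (?t \<alpha>) \<le> H \<alpha>"
    using laurent_terms_majorant[OF g, of "{z}"] z by auto
  then have "(\<lambda>\<alpha>. norm (?t \<alpha>)) summable_on UNIV"
    by (rule summable_on_comparison_test) auto
  then have "?t summable_on UNIV" by (rule abs_summable_summable)
  then obtain s where s: "(?t has_sum s) UNIV"
    unfolding summable_on_def by blast
  then have "(?t has_sum s) Sp"
    by (subst has_sum_cong_neutral[where g = ?t and T = UNIV]) (auto simp: laurent_coeffs_def)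
  then have "(\<lambda>N. \<Sum>\<alpha>\<in>trunc N. ?t \<alpha>) \<longlonglongrightarrow> s"
    by (rule has_sum_imp_trunc_sums_tendsto)
  moreover have "(\<Sum>\<alpha>\<in>trunc N. ?t \<alpha>) = partial_sum g N z" for N
    using trunc_set_subset[of \<Omega> wt p N]
    by (intro sum.cong) (auto simp: laurent_coeffs_def ext_coeff_Ap[OF g])
  ultimately have "s = g z"
    using partial_sum_tendsto_P[OF p_integrable_Ap[OF g] z] LIMSEQ_unique by (simp add: P_reproduces g z)
  then show ?thesis using s by simp
qed

lemma laurent_series_Ap:
  assumes "g \<in> Ap"
  shows "laurent_series \<Omega> g (laurent_coeffs g)"
  unfolding laurent_series_def
proof (intro conjI ballI allI impI has_sum_laurent_terms[OF assms])
  fix K assume K: "compact K \<and> K \<subseteq> \<Omega> \<and> K \<noteq> {}"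
  then obtain H where "H summable_on UNIV"
      "\<And>\<alpha> z. z \<in> K \<Longrightarrow> norm (laurent_coeffs g \<alpha> * monom \<alpha> z) \<le> H \<alpha>"
    using laurent_terms_majorant[OF assms] by metis
  then show "(\<lambda>\<alpha>. SUP z\<in>K. norm (laurent_coeffs g \<alpha> * monom \<alpha> z)) summable_on UNIV"
    using K by (intro summable_on_SUP_norm) auto
qed

lemma laurent_coeff_Ap:
  assumes g: "g \<in> Ap" and \<alpha>: "\<alpha> \<in> Sp"
  shows "laurent_coeff \<Omega> \<alpha> g = coeff \<alpha> g"
proof -
  have "(THE c. laurent_series \<Omega> g c) = laurent_coeffs g"
    using laurent_series_Ap[OF g] laurent_series_unique[OF open_\<Omega> nonempty_\<Omega> reinhardt_\<Omega>]
    by (intro the_equality)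
  then show ?thesis using \<alpha> by (simp add: laurent_coeff_def laurent_coeffs_def)
qed

lemma coeff_opnorm_eq:
  assumes \<alpha>: "\<alpha> \<in> Sp"
  shows "coeff_opnorm \<Omega> wt p \<alpha> = 1 / pnorm (monom \<alpha>)"
  unfolding coeff_opnorm_def
proof (rule cSup_eq_maximum)
  let ?quotients = "{norm (laurent_coeff \<Omega> \<alpha> f) / Lpnorm \<Omega> wt p f |f. f \<in> Ap \<and> 0 < Lpnorm \<Omega> wt p f} \<union> {0}"
  have "1 / pnorm (monom \<alpha>) = norm (laurent_coeff \<Omega> \<alpha> (monom \<alpha>)) / Lpnorm \<Omega> wt p (monom \<alpha>)"
    by (simp add: laurent_coeff_Ap monom_in_Ap \<alpha> coeff_monom Lpnorm_eq_pnorm p_integrable_monom)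
  moreover have "0 < Lpnorm \<Omega> wt p (monom \<alpha>)"
    by (simp add: Lpnorm_eq_pnorm p_integrable_monom pnorm_monom_pos \<alpha>)
  ultimately show "1 / pnorm (monom \<alpha>) \<in> ?quotients"
    using monom_in_Ap[OF \<alpha>] by blast
  fix x assume "x \<in> ?quotients"
  then consider (zero) "x = 0" | (quotient) f where "x = norm (coeff \<alpha> f) / pnorm f" "f \<in> Ap" "0 < pnorm f"
    by (auto simp: laurent_coeff_Ap \<alpha> Lpnorm_eq_pnorm p_integrable_Ap)
  then show "x \<le> 1 / pnorm (monom \<alpha>)"
  proof cases
    case (quotient f)
    then show ?thesis
      using norm_coeff_le[OF \<alpha> p_integrable_Ap, of f] by (simp add: pos_divide_le_eq)
  qed (simp add: p_norm_nonneg)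
qed

lemma norm_preserving_extension_coeff:
  assumes \<alpha>: "\<alpha> \<in> Sp"
  shows "norm_preserving_extension \<Omega> wt p \<alpha> (\<lambda>f. if p_integrable M p f then coeff \<alpha> f else 0)"
  unfolding norm_preserving_extension_def coeff_opnorm_eq[OF \<alpha>]
  using p_gt_1 norm_coeff_le[OF \<alpha>]
  by (auto simp: mem_Lp_space_iff p_integrable_Ap laurent_coeff_Ap \<alpha> p_integrable_add p_integrable_cmult
      norming_functional_add norming_functional_cmult p_integrable_monom Lpnorm_eq_pnorm)

lemma norm_preserving_extension_unique:
  assumes \<alpha>: "\<alpha> \<in> Sp" and \<Phi>: "norm_preserving_extension \<Omega> wt p \<alpha> \<Phi>" and f: "p_integrable M p f"
  shows "\<Phi> f = coeff \<alpha> f"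
proof (rule norming_functional_unique[OF p_gt_1 p_integrable_monom[OF \<alpha>] pnorm_monom_pos[OF \<alpha>]])
  note \<Phi> = \<Phi>[unfolded norm_preserving_extension_def coeff_opnorm_eq[OF \<alpha>]]
  show "\<Phi> (monom \<alpha>) = 1"
    using \<Phi> monom_in_Ap[OF \<alpha>] by (simp add: laurent_coeff_Ap coeff_monom \<alpha>)
  show "\<Phi> (\<lambda>x. g x + h x) = \<Phi> g + \<Phi> h" if "p_integrable M p g" "p_integrable M p h" for g h
    using \<Phi> that by (simp add: mem_Lp_space_iff)
  show "\<Phi> (\<lambda>x. c * g x) = c * \<Phi> g" if "p_integrable M p g" for g c
    using \<Phi> that by (simp add: mem_Lp_space_iff)
  show "norm (\<Phi> g) \<le> pnorm g / pnorm (monom \<alpha>)" if "p_integrable M p g" for g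
    using \<Phi> that by (auto simp: mem_Lp_space_iff Lpnorm_eq_pnorm)
qed (rule f)

lemma ext_coeff_eq:
  assumes \<alpha>: "\<alpha> \<in> Sp" and f: "p_integrable M p f"
  shows "ext_coeff \<Omega> wt p \<alpha> f = coeff \<alpha> f"
proof -
  have "ext_coeff \<Omega> wt p \<alpha> = (\<lambda>f. if p_integrable M p f then coeff \<alpha> f else 0)"
    unfolding ext_coeff_eq_The
  proof (rule the_equality)
    show "norm_preserving_extension \<Omega> wt p \<alpha> (\<lambda>f. if p_integrable M p f then coeff \<alpha> f else 0)"
      by (rule norm_preserving_extension_coeff[OF \<alpha>])
    fix \<Phi> assume \<Phi>: "norm_preserving_extension \<Omega> wt p \<alpha> \<Phi>"
    then have "\<Phi> g = 0" if "\<not> p_integrable M p g" for g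
      using that by (simp add: norm_preserving_extension_def mem_Lp_space_iff)
    then show "\<Phi> = (\<lambda>f. if p_integrable M p f then coeff \<alpha> f else 0)"
      using norm_preserving_extension_unique[OF \<alpha> \<Phi>] by auto
  qed
  then show ?thesis using f by simp
qed

end

section \<open>The monomial basis kernel\<close>

context weighted_reinhardt
begin

abbreviation "q \<equiv> p / (p - 1)"

sublocale conjugate: conjugate_exponents p q
  by (rule conjugate_exponents_divide_pred[OF p_gt_1])

definition kernel_term :: "complex^'n \<Rightarrow> ('n \<Rightarrow> int) \<Rightarrow> complex^'n \<Rightarrow> complex" where
  "kernel_term z \<alpha> w = monom \<alpha> z / of_real (pnorm (monom \<alpha>) powr p) * dual_power p (monom \<alpha> w)"

lemma mb_kernel_eq: "mb_kernel \<Omega> wt p z w = lim (\<lambda>N. \<Sum>\<alpha>\<in>trunc N. kernel_term z \<alpha> w)"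
  unfolding mb_kernel_def kernel_term_def dual_power_def
    Lpnorm_eq_p_norm[OF borel_measurable_wmeasure_monom]
  by (simp add: mult.assoc)

lemma borel_measurable_kernel_term: "kernel_term z \<alpha> \<in> borel_measurable M"
proof -
  note [measurable] = borel_measurable_dual_power[OF p_gt_1] borel_measurable_wmeasure_monom
  show ?thesis unfolding kernel_term_def by measurable
qed

lemma borel_measurable_mb_kernel: "mb_kernel \<Omega> wt p z \<in> borel_measurable M"
proof -
  note [measurable] = borel_measurable_kernel_term
  show ?thesis unfolding mb_kernel_eq[abs_def] by measurable
qed

lemma p_integrable_kernel_term: "\<alpha> \<in> Sp \<Longrightarrow> p_integrable M q (kernel_term z \<alpha>)"
  unfolding kernel_term_def
  by (intro p_integrable_cmult conjugate.p_integrable_dual_power p_integrable_monom)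

lemma p_norm_kernel_term:
  assumes "\<alpha> \<in> Sp"
  shows "p_norm M q (kernel_term z \<alpha>) = norm (monom \<alpha> z) / pnorm (monom \<alpha>)"
proof -
  have "0 < q" using conjugate.q_gt_1 by simp
  then have "p_norm M q (kernel_term z \<alpha>)
      = norm (monom \<alpha> z) / pnorm (monom \<alpha>) powr p * pnorm (monom \<alpha>) powr (p - 1)"
    unfolding kernel_term_def
    using conjugate.p_norm_dual_power[OF p_integrable_monom[OF assms]]
    by (simp only: p_norm_cmult norm_divide norm_of_real) simp
  then show ?thesis
    using pnorm_monom_pos[OF assms] by (simp add: powr_diff)
qed

lemma integral_kernel_term:
  assumes "p_integrable M p f" "\<alpha> \<in> Sp"
  shows "integrable M (\<lambda>w. kernel_term z \<alpha> w * f w)"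
    and "(\<integral>w. kernel_term z \<alpha> w * f w \<partial>M) = coeff \<alpha> f * monom \<alpha> z"
proof -
  have rearrange: "kernel_term z \<alpha> w * f w
      = monom \<alpha> z / of_real (pnorm (monom \<alpha>) powr p) * (f w * dual_power p (monom \<alpha> w))" for w
    by (simp add: kernel_term_def)
  show "integrable M (\<lambda>w. kernel_term z \<alpha> w * f w)"
    unfolding rearrange using assms p_gt_1
    by (intro integrable_mult_right integrable_mult_dual_power p_integrable_monom)
  show "(\<integral>w. kernel_term z \<alpha> w * f w \<partial>M) = coeff \<alpha> f * monom \<alpha> z"
    unfolding rearrange integral_mult_right_zero by (simp add: norming_functional_def)
qed

lemma sum_p_norm_kernel_term_bounded:
  assumes "z \<in> \<Omega>"
  obtains X where "\<And>N. (\<Sum>\<alpha>\<in>trunc N. p_norm M q (kernel_term z \<alpha>)) \<le> X"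
proof -
  have "compact {z}" "{z} \<subseteq> \<Omega>" using assms by auto
  then obtain h where h: "h summable_on UNIV" "\<And>\<alpha>. 0 \<le> h \<alpha>"
      "\<And>\<alpha>. \<alpha> \<in> Sp \<Longrightarrow> norm (monom \<alpha> z) \<le> h \<alpha> * pnorm (monom \<alpha>)"
    by (rule monom_compact_bound) blast
  have "(\<Sum>\<alpha>\<in>trunc N. p_norm M q (kernel_term z \<alpha>)) \<le> infsum h UNIV" for N
  proof -
    have "(\<Sum>\<alpha>\<in>trunc N. p_norm M q (kernel_term z \<alpha>)) \<le> (\<Sum>\<alpha>\<in>trunc N. h \<alpha>)"
      using trunc_set_subset[of \<Omega> wt p N] h(3)
      by (intro sum_mono) (auto simp: p_norm_kernel_term pos_divide_le_eq pnorm_monom_pos)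
    also have "\<dots> \<le> infsum h UNIV"
      using h(1,2) finite_trunc_set by (intro finite_sum_le_infsum) auto
    finally show ?thesis .
  qed
  then show thesis by (rule that)
qed

lemma kernel_majorant:
  assumes z: "z \<in> \<Omega>"
  obtains G :: "complex^'n \<Rightarrow> real" where "p_integrable M q G"
    "AE w in M. \<forall>N. (\<Sum>\<alpha>\<in>trunc N. norm (kernel_term z \<alpha> w)) \<le> G w"
proof -
  obtain X where X: "\<And>N. (\<Sum>\<alpha>\<in>trunc N. p_norm M q (kernel_term z \<alpha>)) \<le> X"
    using sum_p_norm_kernel_term_bounded[OF z] by blast
  define G where "G N w = (\<Sum>\<alpha>\<in>trunc N. norm (kernel_term z \<alpha> w))" for N w
  have "1 \<le> q" using conjugate.q_gt_1 by simp
  have terms: "p_integrable M q (\<lambda>w. norm (kernel_term z \<alpha> w))" if "\<alpha> \<in> trunc N" for \<alpha> N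
    by (intro p_integrable_norm p_integrable_kernel_term subsetD[OF trunc_set_subset that])
  show thesis
  proof (rule p_integrable_monotone_bound[of M q G X])
    show "p_integrable M q (G N)" for N
      unfolding G_def by (intro p_integrable_sum terms \<open>1 \<le> q\<close>)
    have "p_norm M q (G N) \<le> (\<Sum>\<alpha>\<in>trunc N. p_norm M q (\<lambda>w. norm (kernel_term z \<alpha> w)))" for N
      unfolding G_def by (intro p_norm_sum_le terms \<open>1 \<le> q\<close>)
    then show "p_norm M q (G N) \<le> X" for N
      using X unfolding p_norm_norm by (rule order_trans)
    show "G m w \<le> G n w" if "m \<le> n" for m n w
      unfolding G_def by (intro sum_mono2 finite_trunc_set trunc_set_mono that) auto
    show "0 \<le> G N w" for N w
      unfolding G_def by (intro sum_nonneg) simp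
    show "0 < q" using \<open>1 \<le> q\<close> by simp
  qed (use that in \<open>simp add: G_def\<close>)
qed

lemma kernel_partial_sums_tendsto:
  assumes "\<And>N. (\<Sum>\<alpha>\<in>trunc N. norm (kernel_term z \<alpha> w)) \<le> B"
  shows "(\<lambda>N. \<Sum>\<alpha>\<in>trunc N. kernel_term z \<alpha> w) \<longlonglongrightarrow> mb_kernel \<Omega> wt p z w"
  using trunc_sums_bounded_imp_convergent[OF assms] by (simp add: mb_kernel_eq convergent_LIMSEQ_iff)

lemma p_integrable_mb_kernel:
  assumes z: "z \<in> \<Omega>"
  shows "p_integrable M q (mb_kernel \<Omega> wt p z)"
proof -
  obtain G :: "complex^'n \<Rightarrow> real" where G: "p_integrable M q G"
    "AE w in M. \<forall>N. (\<Sum>\<alpha>\<in>trunc N. norm (kernel_term z \<alpha> w)) \<le> G w"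
    using kernel_majorant[OF z] .
  have "AE w in M. norm (mb_kernel \<Omega> wt p z w) \<le> norm (G w)"
    using G(2)
  proof eventually_elim
    case (elim w)
    have "norm (\<Sum>\<alpha>\<in>trunc N. kernel_term z \<alpha> w) \<le> G w" for N
      by (rule order_trans[OF norm_sum]) (use elim in blast)
    then have "norm (mb_kernel \<Omega> wt p z w) \<le> G w"
      using elim by (intro LIMSEQ_le_const2[OF tendsto_norm[OF kernel_partial_sums_tendsto]]) auto
    then show ?case by simp
  qed
  then show ?thesis
    using conjugate.q_gt_1 by (intro p_integrable_bound[OF G(1) borel_measurable_mb_kernel]) auto
qed

end

lemma (in monomial_basis_projection) P_eq_kernel_integral:
  assumes f: "p_integrable M p f" and z: "z \<in> \<Omega>"
  shows "P f z = (\<integral>w. mb_kernel \<Omega> wt p z w * f w \<partial>M)"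
proof -
  let ?S = "\<lambda>N w. \<Sum>\<alpha>\<in>trunc N. kernel_term z \<alpha> w"
  note [measurable] = borel_measurable_p_integrable[OF f] borel_measurable_kernel_term
    borel_measurable_mb_kernel
  obtain G :: "complex^'n \<Rightarrow> real" where G: "p_integrable M q G"
    "AE w in M. \<forall>N. (\<Sum>\<alpha>\<in>trunc N. norm (kernel_term z \<alpha> w)) \<le> G w"
    using kernel_majorant[OF z] .
  have "(\<lambda>N. \<integral>w. ?S N w * f w \<partial>M) \<longlonglongrightarrow> (\<integral>w. mb_kernel \<Omega> wt p z w * f w \<partial>M)"
  proof (rule integral_dominated_convergence[where w = "\<lambda>w. G w * norm (f w)"])
    show "integrable M (\<lambda>w. G w * norm (f w))"
      using conjugate.integrable_mult_p_q[OF p_integrable_norm[OF f] G(1)] by (simp add: mult.commute)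
    show "AE w in M. (\<lambda>N. ?S N w * f w) \<longlonglongrightarrow> mb_kernel \<Omega> wt p z w * f w"
      using G(2) by eventually_elim (intro tendsto_mult tendsto_const kernel_partial_sums_tendsto, blast)
    show "AE w in M. norm (?S N w * f w) \<le> G w * norm (f w)" for N
      using G(2)
    proof eventually_elim
      case (elim w)
      have "norm (?S N w) \<le> G w"
        by (rule order_trans[OF norm_sum]) (use elim in blast)
      then show ?case by (simp add: norm_mult mult_right_mono)
    qed
  qed measurable
  moreover have "(\<integral>w. ?S N w * f w \<partial>M) = partial_sum f N z" for N
  proof -
    have Sp: "\<alpha> \<in> Sp" if "\<alpha> \<in> trunc N" for \<alpha> using that trunc_set_subset by blast
    have "(\<integral>w. ?S N w * f w \<partial>M) = (\<Sum>\<alpha>\<in>trunc N. \<integral>w. kernel_term z \<alpha> w * f w \<partial>M)"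
      unfolding sum_distrib_right by (intro Bochner_Integration.integral_sum integral_kernel_term(1) f Sp)
    also have "\<dots> = partial_sum f N z"
      by (intro sum.cong refl) (simp add: Sp integral_kernel_term(2) f ext_coeff_eq)
    finally show ?thesis .
  qed
  ultimately show ?thesis
    using partial_sum_tendsto_P[OF f z] LIMSEQ_unique by simp
qed

theorem theorem3p5:
  fixes \<Omega> :: "(complex^'n::finite) set"
    and wt :: "complex^'n \<Rightarrow> ennreal"
    and p :: real
    and P :: "(complex^'n \<Rightarrow> complex) \<Rightarrow> (complex^'n \<Rightarrow> complex)"
  assumes "cdomain \<Omega>" and "bounded \<Omega>" and "pseudoconvex \<Omega>" and "reinhardt \<Omega>"
    and "1 < p"
    and "(\<lambda>z. wt z * indicator \<Omega> z) \<in> borel_measurable lebesgue"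
    and "AE z in lebesgue. z \<in> \<Omega> \<longrightarrow> wt z > 0"
    and "admissible \<Omega> wt p" and "multi_radial \<Omega> wt"
    and "is_MBP \<Omega> wt p P"
  shows "(\<forall>f\<in>Lp_space \<Omega> wt p. \<forall>z\<in>\<Omega>.
            P f z = (\<integral>w. mb_kernel \<Omega> wt p z w * f w \<partial>wmeasure \<Omega> wt))
       \<and> (\<forall>z\<in>\<Omega>. mb_kernel \<Omega> wt p z \<in> Lp_space \<Omega> wt (p / (p - 1)))"
proof -
  interpret monomial_basis_projection \<Omega> wt p P
    by unfold_locales (use assms in \<open>auto simp: cdomain_def\<close>)
  show ?thesis
    by (simp add: mem_Lp_space_iff P_eq_kernel_integral p_integrable_mb_kernel)
qed

end
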